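(* There is a constant $c>0$ such that for every $n\ge 2$ and every $n$-vertex graph $G$, Algorithm FIND-DECOMPOSITION (described in the context) finds a decomposition of $G$ into balanced complete bipartite graphs having complexity at most $c\, n^2/\ln n$, i.e., $O(n^2/\ln n)$. The running time of the algorithm is polynomial in $n$.
   Context: A decomposition of a graph $G=(V,E)$ into complete bipartite graphs is a family of complete bipartite subgraphs $G_i=(A_i,B_i,E_i)$, $i=1,\dots,t$, of $G$ (with $A_i,B_i$ disjoint vertex sets and $E_i$ the set of all edges between $A_i$ and $B_i$, all of which lie in $E$) such that the edge sets $E_1,\dots,E_t$ form a partition of $E$. Its complexity is $\sum_{i=1}^t (|A_i|+|B_i|)$. The decomposition is into balanced complete bipartite graphs if $|A_i|=|B_i|$ for all $i$. Algorithm FIND-BIPARTITE: the input is a graph $H$ on $n$ vertices with $m$ edges. Set $q := \lfloor \ln(n/2)/\ln(2en^2/m)\rfloor$ and $r := \lfloor q n^2/m\rfloor$. Let $R$ be a set of $r$ vertices of $H$ of highest degree. For every $q$-element subset $C\subseteq R$, compute $D := \bigcap_{v\in C}(N(v)\setminus R)$ ($N(v)$ the neighbourhood of $v$ in $H$); if $|D|\ge q$, let $D'$ be the first $q$ elements of $D$ and return the complete bipartite subgraph with parts $C$ and $D'$. Algorithm FIND-DECOMPOSITION: there is a fixed threshold $n_0$ (such that FIND-BIPARTITE is guaranteed to return a $K_{q,q}$ on $n$-vertex graphs with $m\ge 3n^{3/2}$ edges whenever $n\ge n_0$). Given an $n$-vertex input graph $G$: if $n<n_0$, use a brute-force method to find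 an optimal (minimum complexity) decomposition of $G$. Otherwise, as long as the current graph (on the vertex set of $G$) has more than $n^2/\ln n$ edges, apply FIND-BIPARTITE to it to find a complete balanced bipartite subgraph and delete the edges of that subgraph from the current graph. After that, form a separate complete bipartite graph $K_{1,1}$ from each remaining edge. The output is the family of all complete bipartite graphs so produced.
   Formalization: For n < n_0 the brute-force step takes an optimal decomposition among balanced ones (the unrestricted optimum of a two-edge path is the unbalanced K_{1,2}); the result is proved for every sufficiently large threshold n_0, with c and the polynomial depending on n_0. *)

theory Defs
  imports
    Complex_Main
    "HOL-Library.Disjoint_Sets"
    "HOL-Library.Monad_Syntax"
    "HOL-Library.While_Combinator"
    "HOL-Computational_Algebra.Polynomial"
begin

section \<open>Graphs and decompositions into complete bipartite graphs\<close>

definition graph :: "'a set \<Rightarrow> 'a set set \<Rightarrow> bool" where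
  "graph V E \<longleftrightarrow> finite V \<and> (\<forall>e\<in>E. e \<subseteq> V \<and> card e = 2)"

definition cross_edges :: "'a set \<times> 'a set \<Rightarrow> 'a set set" where
  "cross_edges = (\<lambda>(A, B). {{a, b} |a b. a \<in> A \<and> b \<in> B})"

definition complete_bipartite_subgraph :: "'a set \<Rightarrow> 'a set set \<Rightarrow> 'a set \<times> 'a set \<Rightarrow> bool" where
  "complete_bipartite_subgraph V E = (\<lambda>(A, B).
     A \<subseteq> V \<and> B \<subseteq> V \<and> A \<inter> B = {} \<and> cross_edges (A, B) \<subseteq> E)"

text \<open>
  A family \<open>G\<^sub>1, \<dots>, G\<^sub>t\<close> is a list of pairs \<open>(A\<^sub>i, B\<^sub>i)\<close>. Distinctness is required because
  \<^const>\<open>partition_on\<close> only sees the set of blocks; together the two conditions say that the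
  \<open>E\<^sub>i\<close> are nonempty, pairwise disjoint for different indices, and have union \<open>E\<close>.
\<close>
definition decomposition :: "'a set \<Rightarrow> 'a set set \<Rightarrow> ('a set \<times> 'a set) list \<Rightarrow> bool" where
  "decomposition V E Gs \<longleftrightarrow>
     (\<forall>G\<in>set Gs. complete_bipartite_subgraph V E G) \<and>
     distinct (map cross_edges Gs) \<and> partition_on E (set (map cross_edges Gs))"

definition balanced :: "('a set \<times> 'a set) list \<Rightarrow> bool" where
  "balanced Gs \<longleftrightarrow> (\<forall>(A, B)\<in>set Gs. card A = card B)"

definition complexity :: "('a set \<times> 'a set) list \<Rightarrow> nat" where
  "complexity Gs = (\<Sum>(A, B)\<leftarrow>Gs. card A + card B)"


section \<open>Step counting\<close>

text \<open>
  \<open>Timed x t\<close> is the result \<open>x\<close> of a computation that took \<open>t\<close> steps. Every call of a routine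
  below (recursive calls included) is charged at least one step through \<open>ret\<close>, and apart from
  calling other charged routines it performs only a bounded number of the following operations,
  which are regarded as constant-time: list and pair constructors and pattern matching, equality
  of vertices, Boolean operations, arithmetic and comparison of numbers, including the evaluation
  of the closed real expressions (with logarithms) for \<open>q\<close>, \<open>r\<close> and the edge threshold.
  Nothing is assumed about vertices except that they can be tested for equality.
\<close>
datatype 'a timed = Timed (result: 'a) (steps: nat)

definition bind_timed :: "'a timed \<Rightarrow> ('a \<Rightarrow> 'b timed) \<Rightarrow> 'b timed" where
  "bind_timed m f = (case m of Timed x s \<Rightarrow> case f x of Timed y t \<Rightarrow> Timed y (s + t))"

adhoc_overloading Monad_Syntax.bind \<rightleftharpoons> bind_timed

definition ret :: "'a \<Rightarrow> 'a timed" where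
  "ret x = Timed x 1"

text \<open>The value is \<^const>\<open>None\<close> iff the loop does not terminate.\<close>
definition while_timed :: "('s \<Rightarrow> bool timed) \<Rightarrow> ('s \<Rightarrow> 's timed) \<Rightarrow> 's \<Rightarrow> 's timed option" where
  "while_timed b c s =
     map_option (\<lambda>(s', t). Timed s' (t + steps (b s') + 1))
       (while_option (\<lambda>(s', t). result (b s'))
          (\<lambda>(s', t). (result (c s'), t + steps (b s') + steps (c s') + 1)) (s, 0))"


section \<open>List routines\<close>

fun length_t :: "'a list \<Rightarrow> nat timed" where
  "length_t [] = ret 0"
| "length_t (x # xs) = do { k \<leftarrow> length_t xs; ret (k + 1) }"

fun append_t :: "'a list \<Rightarrow> 'a list \<Rightarrow> 'a list timed" where
  "append_t [] ys = ret ys"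
| "append_t (x # xs) ys = do { zs \<leftarrow> append_t xs ys; ret (x # zs) }"

fun take_t :: "nat \<Rightarrow> 'a list \<Rightarrow> 'a list timed" where
  "take_t 0 xs = ret []"
| "take_t (Suc k) [] = ret []"
| "take_t (Suc k) (x # xs) = do { ys \<leftarrow> take_t k xs; ret (x # ys) }"

fun map_t :: "('a \<Rightarrow> 'b timed) \<Rightarrow> 'a list \<Rightarrow> 'b list timed" where
  "map_t f [] = ret []"
| "map_t f (x # xs) = do { y \<leftarrow> f x; ys \<leftarrow> map_t f xs; ret (y # ys) }"

fun filter_t :: "('a \<Rightarrow> bool timed) \<Rightarrow> 'a list \<Rightarrow> 'a list timed" where
  "filter_t p [] = ret []"
| "filter_t p (x # xs) =
     do { b \<leftarrow> p x; ys \<leftarrow> filter_t p xs; ret (if b then x # ys else ys) }"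

fun all_t :: "('a \<Rightarrow> bool timed) \<Rightarrow> 'a list \<Rightarrow> bool timed" where
  "all_t p [] = ret True"
| "all_t p (x # xs) = do { b \<leftarrow> p x; c \<leftarrow> all_t p xs; ret (b \<and> c) }"

fun any_t :: "('a \<Rightarrow> bool timed) \<Rightarrow> 'a list \<Rightarrow> bool timed" where
  "any_t p [] = ret False"
| "any_t p (x # xs) = do { b \<leftarrow> p x; c \<leftarrow> any_t p xs; ret (b \<or> c) }"

definition member_t :: "'a \<Rightarrow> 'a list \<Rightarrow> bool timed" where
  "member_t x ys = any_t (\<lambda>y. ret (x = y)) ys"

fun product_t :: "'a list \<Rightarrow> 'b list \<Rightarrow> ('a \<times> 'b) list timed" where
  "product_t [] ys = ret []"
| "product_t (x # xs) ys =
     do { ps \<leftarrow> map_t (\<lambda>y. ret (x, y)) ys; qs \<leftarrow> product_t xs ys;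
          rs \<leftarrow> append_t ps qs; ret rs }"

text \<open>All sublists, i.e. all subsets of a set given by a distinct list.\<close>
fun sublists_t :: "'a list \<Rightarrow> 'a list list timed" where
  "sublists_t [] = ret [[]]"
| "sublists_t (x # xs) =
     do { yss \<leftarrow> sublists_t xs; zss \<leftarrow> map_t (\<lambda>ys. ret (x # ys)) yss;
          wss \<leftarrow> append_t zss yss; ret wss }"

text \<open>All sublists of length \<open>k\<close>.\<close>
fun combinations_t :: "nat \<Rightarrow> 'a list \<Rightarrow> 'a list list timed" where
  "combinations_t 0 xs = ret [[]]"
| "combinations_t (Suc k) [] = ret []"
| "combinations_t (Suc k) (x # xs) =
     do { yss \<leftarrow> combinations_t k xs; uss \<leftarrow> combinations_t (Suc k) xs;
          zss \<leftarrow> map_t (\<lambda>ys. ret (x # ys)) yss; wss \<leftarrow> append_t zss uss; ret wss }"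

text \<open>Insertion sort of pairs by decreasing first component.\<close>
fun insert_desc_t :: "nat \<times> 'a \<Rightarrow> (nat \<times> 'a) list \<Rightarrow> (nat \<times> 'a) list timed" where
  "insert_desc_t p [] = ret [p]"
| "insert_desc_t p (s # ss) =
     (if fst s \<le> fst p then ret (p # s # ss)
      else do { us \<leftarrow> insert_desc_t p ss; ret (s # us) })"

fun sort_desc_t :: "(nat \<times> 'a) list \<Rightarrow> (nat \<times> 'a) list timed" where
  "sort_desc_t [] = ret []"
| "sort_desc_t (p # ps) =
     do { ss \<leftarrow> sort_desc_t ps; us \<leftarrow> insert_desc_t p ss; ret us }"


section \<open>Input graphs\<close>

text \<open>
  A graph is presented to the algorithms as a list of its vertices and a list of its edges,
  each without repetition; the order of the lists and the orientation of the pairs are arbitrary.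
\<close>
definition edge_of :: "'a \<times> 'a \<Rightarrow> 'a set" where
  "edge_of = (\<lambda>(u, v). {u, v})"

definition represents :: "'a list \<Rightarrow> ('a \<times> 'a) list \<Rightarrow> 'a set \<Rightarrow> 'a set set \<Rightarrow> bool" where
  "represents vs es V E \<longleftrightarrow>
     distinct vs \<and> set vs = V \<and> distinct (map edge_of es) \<and> set (map edge_of es) = E"

definition part_sets :: "'a list \<times> 'a list \<Rightarrow> 'a set \<times> 'a set" where
  "part_sets = (\<lambda>(A, B). (set A, set B))"

definition adjacent_t :: "('a \<times> 'a) list \<Rightarrow> 'a \<Rightarrow> 'a \<Rightarrow> bool timed" where
  "adjacent_t es u v = any_t (\<lambda>(x, y). ret (x = u \<and> y = v \<or> x = v \<and> y = u)) es"

definition degree_t :: "('a \<times> 'a) list \<Rightarrow> 'a \<Rightarrow> nat timed" where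
  "degree_t es v = do { inc \<leftarrow> filter_t (\<lambda>(x, y). ret (x = v \<or> y = v)) es; length_t inc }"


section \<open>FIND-BIPARTITE\<close>

definition param_q :: "nat \<Rightarrow> nat \<Rightarrow> nat" where
  "param_q n m = nat \<lfloor>ln (real n / 2) / ln (2 * exp 1 * (real n)\<^sup>2 / real m)\<rfloor>"

definition param_r :: "nat \<Rightarrow> nat \<Rightarrow> nat" where
  "param_r n m = nat \<lfloor>real (param_q n m) * (real n)\<^sup>2 / real m\<rfloor>"

definition highest_degree_t :: "nat \<Rightarrow> 'a list \<Rightarrow> ('a \<times> 'a) list \<Rightarrow> 'a list timed" where
  "highest_degree_t r vs es =
     do { ps \<leftarrow> map_t (\<lambda>v. do { d \<leftarrow> degree_t es v; ret (d, v) }) vs;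
          ss \<leftarrow> sort_desc_t ps;
          ts \<leftarrow> take_t r ss;
          map_t (\<lambda>p. ret (snd p)) ts }"

text \<open>The vertices outside \<open>R\<close> that are adjacent to all of \<open>C\<close>.\<close>
definition common_nbrs_t :: "'a list \<Rightarrow> ('a \<times> 'a) list \<Rightarrow> 'a list \<Rightarrow> 'a list \<Rightarrow> 'a list timed" where
  "common_nbrs_t vs es R C =
     filter_t (\<lambda>w. do { b \<leftarrow> member_t w R; c \<leftarrow> all_t (\<lambda>v. adjacent_t es v w) C;
                        ret (\<not> b \<and> c) }) vs"

fun search_t ::
  "nat \<Rightarrow> 'a list \<Rightarrow> ('a \<times> 'a) list \<Rightarrow> 'a list \<Rightarrow> 'a list list \<Rightarrow> ('a list \<times> 'a list) option timed"
where
  "search_t q vs es R [] = ret None"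
| "search_t q vs es R (C # Cs) =
     do { D \<leftarrow> common_nbrs_t vs es R C;
          d \<leftarrow> length_t D;
          if q \<le> d then do { D' \<leftarrow> take_t q D; ret (Some (C, D')) }
          else do { res \<leftarrow> search_t q vs es R Cs; ret res } }"

definition find_bipartite ::
  "'a list \<Rightarrow> ('a \<times> 'a) list \<Rightarrow> ('a list \<times> 'a list) option timed" where
  "find_bipartite vs es =
     do { n \<leftarrow> length_t vs;
          m \<leftarrow> length_t es;
          q \<leftarrow> ret (param_q n m);
          r \<leftarrow> ret (param_r n m);
          R \<leftarrow> highest_degree_t r vs es;
          Cs \<leftarrow> combinations_t q R;
          search_t q vs es R Cs }"

text \<open>
  \<open>n\<^sub>0\<close> is a threshold beyond which FIND-BIPARTITE succeeds on all graphs with at least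
  \<open>3n\<^bsup>3/2\<^esup>\<close> edges. The vertex type is fixed so that the notion does not depend on it.
\<close>
definition bipartite_threshold :: "nat \<Rightarrow> bool" where
  "bipartite_threshold n\<^sub>0 \<longleftrightarrow>
     (\<forall>(V :: nat set) E vs es. graph V E \<and> represents vs es V E \<and>
        n\<^sub>0 \<le> card V \<and> 3 * real (card V) powr (3 / 2) \<le> real (card E) \<longrightarrow>
        (\<exists>C D. result (find_bipartite vs es) = Some (C, D) \<and>
           complete_bipartite_subgraph V E (set C, set D) \<and>
           card (set C) = param_q (card V) (card E) \<and>
           card (set D) = param_q (card V) (card E)))"


section \<open>Brute force\<close>

definition is_balanced_biclique_t :: "('a \<times> 'a) list \<Rightarrow> 'a list \<times> 'a list \<Rightarrow> bool timed" where
  "is_balanced_biclique_t es = (\<lambda>(A, B).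
     do { a \<leftarrow> length_t A;
          b \<leftarrow> length_t B;
          c \<leftarrow> all_t (\<lambda>x. do { i \<leftarrow> member_t x B; ret (\<not> i) }) A;
          d \<leftarrow> all_t (\<lambda>x. all_t (\<lambda>y. adjacent_t es x y) B) A;
          ret (0 < a \<and> a = b \<and> c \<and> d) })"

definition covers_t :: "'a \<times> 'a \<Rightarrow> 'a list \<times> 'a list \<Rightarrow> bool timed" where
  "covers_t = (\<lambda>(u, v) (A, B).
     do { a \<leftarrow> member_t u A; b \<leftarrow> member_t v B; c \<leftarrow> member_t v A; d \<leftarrow> member_t u B;
          ret (a \<and> b \<or> c \<and> d) })"

definition covers_exactly_t :: "('a \<times> 'a) list \<Rightarrow> ('a list \<times> 'a list) list \<Rightarrow> bool timed" where
  "covers_exactly_t es F =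
     all_t (\<lambda>e. do { G \<leftarrow> filter_t (covers_t e) F; k \<leftarrow> length_t G; ret (k = 1) }) es"

fun complexity_t :: "('a list \<times> 'a list) list \<Rightarrow> nat timed" where
  "complexity_t [] = ret 0"
| "complexity_t (G # Gs) =
     do { a \<leftarrow> length_t (fst G); b \<leftarrow> length_t (snd G); k \<leftarrow> complexity_t Gs;
          ret (a + b + k) }"

fun cheapest_t ::
  "('a list \<times> 'a list) list list \<Rightarrow> (nat \<times> ('a list \<times> 'a list) list) option timed" where
  "cheapest_t [] = ret None"
| "cheapest_t (F # Fs) =
     do { k \<leftarrow> complexity_t F;
          best \<leftarrow> cheapest_t Fs;
          ret (case best of
                 None \<Rightarrow> Some (k, F)
               | Some (k', F') \<Rightarrow> Some (if k \<le> k' then (k, F) else (k', F'))) }"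

text \<open>
  Exhaustive search through all sets of balanced complete bipartite subgraphs for a decomposition
  of minimum complexity. The optimum is taken over balanced decompositions: the unrestricted
  optimum need not be balanced, e.g. for a path with two edges.
\<close>
definition brute_force :: "'a list \<Rightarrow> ('a \<times> 'a) list \<Rightarrow> ('a list \<times> 'a list) list timed" where
  "brute_force vs es =
     do { As \<leftarrow> sublists_t vs;
          ABs \<leftarrow> product_t As As;
          Gs \<leftarrow> filter_t (is_balanced_biclique_t es) ABs;
          Fs \<leftarrow> sublists_t Gs;
          Ds \<leftarrow> filter_t (covers_exactly_t es) Fs;
          best \<leftarrow> cheapest_t Ds;
          ret (case best of None \<Rightarrow> [] | Some (k, F) \<Rightarrow> F) }"


section \<open>FIND-DECOMPOSITION\<close>

definition delete_edges_t ::
  "'a list \<times> 'a list \<Rightarrow> ('a \<times> 'a) list \<Rightarrow> ('a \<times> 'a) list timed" where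
  "delete_edges_t G es = filter_t (\<lambda>e. do { b \<leftarrow> covers_t e G; ret (\<not> b) }) es"

text \<open>The loop state consists of the current edges and the bipartite graphs found so far.\<close>
type_synonym 'a peel_state = "('a \<times> 'a) list \<times> ('a list \<times> 'a list) list"

definition many_edges_t :: "nat \<Rightarrow> 'a peel_state \<Rightarrow> bool timed" where
  "many_edges_t n = (\<lambda>(es, F).
     do { m \<leftarrow> length_t es; ret (real m > (real n)\<^sup>2 / ln (real n)) })"

text \<open>
  If no bipartite graph is found then the state is unchanged and the loop runs forever.
\<close>
definition peel_t :: "'a list \<Rightarrow> 'a peel_state \<Rightarrow> 'a peel_state timed" where
  "peel_t vs = (\<lambda>(es, F).
     do { res \<leftarrow> find_bipartite vs es;
          case res of
            None \<Rightarrow> ret (es, F)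
          | Some G \<Rightarrow> do { es' \<leftarrow> delete_edges_t G es; ret (es', G # F) } })"

text \<open>The value is \<^const>\<open>None\<close> iff the algorithm does not terminate.\<close>
definition find_decomposition ::
  "nat \<Rightarrow> 'a list \<Rightarrow> ('a \<times> 'a) list \<Rightarrow> ('a list \<times> 'a list) list timed option" where
  "find_decomposition n\<^sub>0 vs es =
     (let size = length_t vs; n = result size in
      if n < n\<^sub>0 then Some (do { _ \<leftarrow> size; brute_force vs es })
      else map_option
        (\<lambda>loop. do { _ \<leftarrow> size;
                     s \<leftarrow> loop;
                     Ks \<leftarrow> map_t (\<lambda>(u, v). ret ([u], [v])) (fst s);
                     append_t (snd s) Ks })
        (while_timed (many_edges_t n) (peel_t vs) (es, [])))"

end

theory Submission
  imports Defs "HOL-Library.Multiset" "HOL-Library.Sublist"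
begin

text \<open>
  If FIND-BIPARTITE fails, then every \<open>q\<close>-subset of the \<open>r\<close> high-degree vertices \<open>R\<close> has fewer than
  \<open>q\<close> common neighbours outside \<open>R\<close>. Since \<open>k \<le> (k choose q) + q - 1\<close>, double counting bounds the
  number of edges leaving \<open>R\<close> by \<open>(q - 1) ((r choose q) + n) < (q - 1/2) n\<close>, whereas \<open>r\<close> vertices of
  highest degree send at least \<open>r (2 m / n - r) \<ge> (q - 1/2) n\<close> edges out of \<open>R\<close>. The choice of \<open>q\<close> also
  makes \<open>r choose q \<le> n / 2\<close>, so the enumeration of the \<open>q\<close>-subsets is polynomial.

  A \<open>K\<^bsub>q,q\<^esub>\<close> costs \<open>2 / q\<close> per deleted edge, which is at most \<open>4 ln (2 e n\<^sup>2 / m) / ln (n / 2)\<close> when \<open>m\<close>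
  edges are left. Integrating over \<open>m\<close> from \<open>0\<close> to \<open>n\<^sup>2 / 2\<close> gives \<open>O(n\<^sup>2 / ln n)\<close> in total.
\<close>

section \<open>Timed computations\<close>

text \<open>The factor 2 in \<open>2 * exp 1 * n^2 / m\<close> is what closes the count: it
  strengthens the estimate of \<open>r choose q\<close> to
  \<open>(r choose q) * 2 ^ q \<le> n / 2\<close>, and \<open>2 ^ q\<close> outweighs the multiplier
  \<open>q - 1\<close>. The density hypothesis enters through \<open>q * n ^ 3 \<le> m^2\<close>,
  which gives \<open>r * n \<le> m\<close>; adjacencies inside \<open>R\<close> then consume at most
  half of the degree sum that the choice of \<open>R\<close> guarantees. FIND-BIPARTITE already
  succeeds from 16 vertices on. The loop needs more: it must never meet a graph with more than
  \<open>n^2 / ln n\<close> but fewer than \<open>3 n^(3/2)\<close> edges. This amounts to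
  \<open>3 ln n \<le> sqrt n\<close> and is secured by 20736 = 12^4. The integral is not formalised
  as such. Its antiderivative serves as a potential, and concavity turns the comparison into one
  inequality per round. Running time is amortised in the same way, each round being charged to one
  deleted edge. Inputs below the threshold have finitely many sizes, so exhaustive search only
  affects the constants.\<close>

lemma result_bind_timed [simp]: "result (bind_timed m f) = result (f (result m))"
  by (simp add: bind_timed_def split: timed.splits)

lemma steps_bind_timed [simp]: "steps (bind_timed m f) = steps m + steps (f (result m))"
  by (simp add: bind_timed_def split: timed.splits)

lemma result_ret [simp]: "result (ret x) = x"
  by (simp add: ret_def)

lemma steps_ret [simp]: "steps (ret x) = 1"
  by (simp add: ret_def)

lemma result_case_prod [simp]: "result (case p of (x, y) \<Rightarrow> f x y) = (case p of (x, y) \<Rightarrow> result (f x y))"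
  by (cases p) simp

lemma steps_case_prod [simp]: "steps (case p of (x, y) \<Rightarrow> f x y) = (case p of (x, y) \<Rightarrow> steps (f x y))"
  by (cases p) simp

lemma result_length_t [simp]: "result (length_t xs) = length xs"
  by (induction xs) auto

lemma steps_length_t [simp]: "steps (length_t xs) = length xs + 1"
  by (induction xs) auto

lemma result_append_t [simp]: "result (append_t xs ys) = xs @ ys"
  by (induction xs) auto

lemma steps_append_t [simp]: "steps (append_t xs ys) = length xs + 1"
  by (induction xs) auto

lemma result_take_t [simp]: "result (take_t k xs) = take k xs"
  by (induction k xs rule: take_t.induct) auto

lemma steps_take_t: "steps (take_t k xs) \<le> length xs + 1"
  by (induction k xs rule: take_t.induct) auto

lemma result_map_t [simp]: "result (map_t f xs) = map (\<lambda>x. result (f x)) xs"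
  by (induction xs) auto

lemma steps_map_t:
  assumes "\<And>x. x \<in> set xs \<Longrightarrow> steps (f x) \<le> K"
  shows "steps (map_t f xs) \<le> (K + 1) * length xs + 1"
  using assms by (induction xs) fastforce+

lemma result_filter_t [simp]: "result (filter_t p xs) = filter (\<lambda>x. result (p x)) xs"
  by (induction xs) auto

lemma steps_filter_t:
  assumes "\<And>x. x \<in> set xs \<Longrightarrow> steps (p x) \<le> K"
  shows "steps (filter_t p xs) \<le> (K + 1) * length xs + 1"
  using assms by (induction xs) fastforce+

lemma result_all_t [simp]: "result (all_t p xs) \<longleftrightarrow> (\<forall>x\<in>set xs. result (p x))"
  by (induction xs) auto

lemma steps_all_t:
  assumes "\<And>x. x \<in> set xs \<Longrightarrow> steps (p x) \<le> K"
  shows "steps (all_t p xs) \<le> (K + 1) * length xs + 1"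
  using assms by (induction xs) fastforce+

lemma result_any_t [simp]: "result (any_t p xs) \<longleftrightarrow> (\<exists>x\<in>set xs. result (p x))"
  by (induction xs) auto

lemma steps_any_t:
  assumes "\<And>x. x \<in> set xs \<Longrightarrow> steps (p x) \<le> K"
  shows "steps (any_t p xs) \<le> (K + 1) * length xs + 1"
  using assms by (induction xs) fastforce+

lemma result_member_t [simp]: "result (member_t x ys) \<longleftrightarrow> x \<in> set ys"
  by (auto simp: member_t_def)

lemma steps_member_t: "steps (member_t x ys) \<le> 2 * length ys + 1"
  unfolding member_t_def by (rule order_trans[OF steps_any_t[where K = 1]]) auto

lemma result_product_t [simp]: "result (product_t xs ys) = List.product xs ys"
  by (induction xs) auto

lemma steps_product_t: "steps (product_t xs ys) \<le> length xs * (3 * length ys + 3) + 1"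
proof (induction xs)
  case (Cons x xs)
  have "steps (map_t (\<lambda>y. ret (x, y)) ys) \<le> 2 * length ys + 1"
    by (rule order_trans[OF steps_map_t[where K = 1]]) auto
  with Cons show ?case by (simp add: algebra_simps)
qed auto

section \<open>Enumeration of subsets and of subsets of fixed size\<close>

lemma result_sublists_t [simp]: "result (sublists_t xs) = subseqs xs"
  by (induction xs) (auto simp: Let_def)

text \<open>The true order is \<open>2 ^ length xs\<close>; base 4 leaves room for the additive
  terms in the induction. Only the brute-force search, on inputs of bounded size, enumerates all
  sublists.\<close>

lemma steps_sublists_t: "steps (sublists_t xs) \<le> 6 * 4 ^ length xs"
proof (induction xs)
  case (Cons x xs)
  have "steps (map_t (\<lambda>ys. ret (x # ys)) (subseqs xs)) \<le> 2 * length (subseqs xs) + 1"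
    by (rule order_trans[OF steps_map_t[where K = 1]]) auto
  moreover have "(2::nat) ^ length xs \<le> 4 ^ length xs" "1 \<le> (4::nat) ^ length xs"
    by (auto intro: power_mono)
  moreover have "steps (sublists_t (x # xs)) = steps (sublists_t xs)
      + steps (map_t (\<lambda>ys. ret (x # ys)) (subseqs xs)) + 2 ^ length xs + 2"
    by (simp add: length_subseqs)
  moreover have "(4::nat) ^ length (x # xs) = 4 * 4 ^ length xs" by simp
  ultimately show ?case using Cons unfolding length_subseqs by linarith
qed auto

lemma result_combinations_t [simp]:
  "result (combinations_t k xs) = filter (\<lambda>ys. length ys = k) (subseqs xs)"
proof (induction k xs rule: combinations_t.induct)
  case (1 xs)
  show ?case by (induction xs) (auto simp: Let_def filter_map o_def)
qed (auto simp: Let_def filter_map o_def)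

lemma length_combinations_t: "length (result (combinations_t k xs)) = length xs choose k"
  unfolding result_combinations_t[symmetric]
  by (induction k xs rule: combinations_t.induct) (auto simp del: result_combinations_t)

text \<open>Pascal's rule for partial row sums, matching the two recursive calls of
  \<open>combinations_t\<close>.\<close>

lemma sum_choose_Suc_Suc:
  "(\<Sum>j\<le>Suc k. Suc l choose j) = (\<Sum>j\<le>k. l choose j) + (\<Sum>j\<le>Suc k. l choose j)"
proof -
  have "(\<Sum>j\<le>Suc k. Suc l choose j) = 1 + (\<Sum>j\<le>k. Suc l choose Suc j)"
    by (subst sum.atMost_Suc_shift) simp
  also have "\<dots> = 1 + (\<Sum>j\<le>k. l choose j) + (\<Sum>j\<le>k. l choose Suc j)"
    by (simp add: sum.distrib)
  also have "\<dots> = (\<Sum>j\<le>k. l choose j) + (\<Sum>j\<le>Suc k. l choose j)"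
    unfolding sum.atMost_Suc_shift[of "\<lambda>j. l choose j" k] by simp
  finally show ?thesis .
qed

text \<open>The partial sum counts the leaves of the call tree: a branch also ends when the list
  runs out with fewer than \<open>k\<close> elements chosen, so \<open>length xs choose k\<close>
  alone would not suffice. The factor \<open>length xs + 1\<close> pays for prefixing and appending
  at each level.\<close>

lemma steps_combinations_t:
  "steps (combinations_t k xs) \<le> 6 * (length xs + 1) * (\<Sum>j\<le>k. length xs choose j)"
proof (induction k xs rule: combinations_t.induct)
  case (2 k)
  have "1 \<le> (\<Sum>j\<le>Suc k. 0 choose j)" by (subst sum.atMost_Suc_shift) simp
  then show ?case by simp
next
  case (3 k x xs)
  let ?l = "length xs"
  let ?S = "\<lambda>k. \<Sum>j\<le>k. ?l choose j"
  have "steps (map_t (\<lambda>ys. ret (x # ys)) (result (combinations_t k xs)))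
      \<le> 2 * length (result (combinations_t k xs)) + 1"
    by (rule order_trans[OF steps_map_t[where K = 1]]) auto
  then have "steps (combinations_t (Suc k) (x # xs))
      \<le> 6 * (?l + 1) * ?S k + 6 * (?l + 1) * ?S (Suc k) + 3 * (?l choose k) + 3"
    using 3 by (simp add: length_combinations_t del: result_combinations_t sum.atMost_Suc)
  moreover have "?l choose k \<le> ?S k" by (rule member_le_sum) auto
  moreover have "?l choose 0 \<le> ?S k" by (rule member_le_sum) auto
  ultimately show ?case
    by (simp add: sum_choose_Suc_Suc algebra_simps del: sum.atMost_Suc)
qed auto

section \<open>Sorting by degree, adjacency tests and degrees\<close>

lemma mset_insert_desc_t [simp]: "mset (result (insert_desc_t p ss)) = add_mset p (mset ss)"
  by (induction p ss rule: insert_desc_t.induct) auto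

lemma mset_sort_desc_t [simp]: "mset (result (sort_desc_t ps)) = mset ps"
  by (induction ps) auto

lemma sorted_insert_desc_t:
  assumes "sorted_wrt (\<lambda>p s. fst s \<le> fst p) ss"
  shows "sorted_wrt (\<lambda>p s. fst s \<le> fst p) (result (insert_desc_t p ss))"
  using assms
proof (induction p ss rule: insert_desc_t.induct)
  case (2 p s ss)
  have "set (result (insert_desc_t p ss)) = insert p (set ss)"
    by (metis mset_insert_desc_t set_mset_add_mset_insert set_mset_mset)
  with 2 show ?case by fastforce
qed auto

lemma sorted_sort_desc_t: "sorted_wrt (\<lambda>p s. fst s \<le> fst p) (result (sort_desc_t ps))"
  by (induction ps) (auto intro: sorted_insert_desc_t)

lemma steps_insert_desc_t: "steps (insert_desc_t p ss) \<le> length ss + 1"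
  by (induction p ss rule: insert_desc_t.induct) auto

lemma length_sort_desc_t [simp]: "length (result (sort_desc_t ps)) = length ps"
  by (metis mset_sort_desc_t size_mset)

lemma steps_sort_desc_t: "steps (sort_desc_t ps) \<le> length ps * (length ps + 2) + 1"
proof (induction ps)
  case (Cons p ps)
  then show ?case
    using steps_insert_desc_t[of p "result (sort_desc_t ps)"] by (simp add: algebra_simps)
qed auto

lemma result_adjacent_t:
  "result (adjacent_t es u v) \<longleftrightarrow> {u, v} \<in> set (map edge_of es)"
  by (force simp: adjacent_t_def edge_of_def doubleton_eq_iff)

lemma steps_adjacent_t: "steps (adjacent_t es u v) \<le> 2 * length es + 1"
  unfolding adjacent_t_def
  by (rule order_trans[OF steps_any_t[where K = 1]]) (auto split: prod.split)

text \<open>Distinctness is required of the edges as sets: otherwise \<open>(u, v)\<close> and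
  \<open>(v, u)\<close> could count one edge twice.\<close>

lemma result_degree_t:
  assumes "distinct (map edge_of es)"
  shows "result (degree_t es v) = card {e \<in> set (map edge_of es). v \<in> e}"
proof -
  let ?fs = "filter (\<lambda>p. v \<in> edge_of p) es"
  have "result (degree_t es v) = length (map edge_of ?fs)"
    by (simp add: degree_t_def edge_of_def case_prod_unfold eq_commute)
  also have "\<dots> = card (set (map edge_of ?fs))"
    by (metis assms distinct_card distinct_map_filter)
  also have "set (map edge_of ?fs) = {e \<in> set (map edge_of es). v \<in> e}" by auto
  finally show ?thesis .
qed

lemma steps_degree_t: "steps (degree_t es v) \<le> 3 * length es + 2"
proof -
  have "steps (filter_t (\<lambda>(x, y). ret (x = v \<or> y = v)) es) \<le> 2 * length es + 1"
    by (rule order_trans[OF steps_filter_t[where K = 1]]) (auto split: prod.split)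
  moreover have "length (result (filter_t (\<lambda>(x, y). ret (x = v \<or> y = v)) es)) \<le> length es"
    by simp
  ultimately show ?thesis by (simp add: degree_t_def del: result_filter_t)
qed

section \<open>Counting\<close>

text \<open>By Pascal's rule \<open>k choose q\<close> grows by \<open>k choose (q - 1)\<close>,
  hence by at least 1 once \<open>k \<ge> q - 1\<close>. This linear bound takes the place of the
  convexity of binomial coefficients in the usual double count.\<close>

lemma le_choose_plus_pred:
  assumes "0 < q"
  shows "k \<le> (k choose q) + (q - 1)"
proof (induction k)
  case (Suc k)
  obtain p where q: "q = Suc p" using assms gr0_conv_Suc by blast
  show ?case
  proof (cases "p \<le> k")
    case True
    then have "1 \<le> k choose p" by (simp add: Suc_leI zero_less_binomial)
    with Suc q show ?thesis by simp
  qed (use q in auto)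
qed simp

text \<open>Pairs \<open>(w, C)\<close> with \<open>C\<close> a \<open>q\<close>-set of neighbours
  of \<open>w\<close> are counted twice. By vertex, they make up for the degrees except for
  \<open>q - 1\<close> per \<open>w\<close>; by subset, each \<open>C\<close> contributes at most
  \<open>q - 1\<close>.\<close>

lemma sum_degrees_le_if_no_biclique:
  assumes fin: "finite R" "finite W" and q: "0 < q"
    and less: "\<And>C. C \<subseteq> R \<Longrightarrow> card C = q \<Longrightarrow> card {w \<in> W. \<forall>v\<in>C. P v w} < q"
  shows "(\<Sum>v\<in>R. card {w \<in> W. P v w}) \<le> (q - 1) * ((card R choose q) + card W)"
proof -
  let ?N = "\<lambda>w. {v \<in> R. P v w}"
  let ?S = "{C. C \<subseteq> R \<and> card C = q}"
  have finS: "finite ?S" using fin by simp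
  have "(\<Sum>v\<in>R. card {w \<in> W. P v w}) = (\<Sum>w\<in>W. card (?N w))"
    using sum.swap_restrict[OF fin, of "\<lambda>_ _. 1 :: nat" P] by simp
  also have "\<dots> \<le> (\<Sum>w\<in>W. (card (?N w) choose q) + (q - 1))"
    by (intro sum_mono le_choose_plus_pred q)
  also have "\<dots> = (\<Sum>w\<in>W. card (?N w) choose q) + (q - 1) * card W"
    by (simp add: sum.distrib)
  also have "(\<Sum>w\<in>W. card (?N w) choose q) = (\<Sum>w\<in>W. card {C \<in> ?S. \<forall>v\<in>C. P v w})"
  proof (rule sum.cong)
    fix w
    have "{C \<in> ?S. \<forall>v\<in>C. P v w} = {C. C \<subseteq> ?N w \<and> card C = q}" by auto
    then show "(card (?N w) choose q) = card {C \<in> ?S. \<forall>v\<in>C. P v w}"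
      using fin by (simp add: n_subsets)
  qed simp
  also have "\<dots> = (\<Sum>C\<in>?S. card {w \<in> W. \<forall>v\<in>C. P v w})"
    using sum.swap_restrict[OF fin(2) finS, of "\<lambda>_ _. 1 :: nat" "\<lambda>w C. \<forall>v\<in>C. P v w"] by simp
  also have "\<dots> \<le> (\<Sum>C\<in>?S. q - 1)"
  proof (rule sum_mono)
    fix C assume "C \<in> ?S"
    then show "card {w \<in> W. \<forall>v\<in>C. P v w} \<le> q - 1" using less[of C] by simp
  qed
  also have "\<dots> = (q - 1) * (card R choose q)"
    using n_subsets[OF fin(1), of q] by simp
  finally show ?thesis by (simp add: algebra_simps)
qed

text \<open>Averaging: every element of \<open>R\<close> dominates every element outside it, so the
  mean of \<open>f\<close> over \<open>R\<close> is at least the mean over \<open>V\<close>. The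
  form is cross-multiplied to stay within natural numbers.\<close>

lemma card_mult_sum_le_top:
  fixes f :: "'a \<Rightarrow> nat"
  assumes "finite V" "R \<subseteq> V" and top: "\<And>v w. v \<in> R \<Longrightarrow> w \<in> V - R \<Longrightarrow> f w \<le> f v"
  shows "card R * sum f V \<le> card V * sum f R"
proof -
  have "card R * sum f (V - R) = (\<Sum>v\<in>R. \<Sum>w\<in>V - R. f w)" by simp
  also have "\<dots> \<le> (\<Sum>v\<in>R. \<Sum>w\<in>V - R. f v)" by (intro sum_mono top)
  also have "\<dots> = card (V - R) * sum f R" by (simp add: sum_distrib_left)
  finally have "card R * sum f (V - R) \<le> card (V - R) * sum f R" .
  moreover have "sum f V = sum f (V - R) + sum f R" by (rule sum.subset_diff[OF assms(2,1)])
  moreover have "card V = card (V - R) + card R"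
    using assms by (metis card_Diff_subset card_mono finite_subset le_add_diff_inverse2)
  ultimately show ?thesis by (simp add: algebra_simps)
qed

section \<open>Degree sums and the number of edges\<close>

lemma finite_graph_edges: "graph V E \<Longrightarrow> finite E"
  unfolding graph_def by (meson Pow_iff finite_Pow_iff finite_subset subsetI)

lemma sum_degrees:
  assumes "graph V E"
  shows "(\<Sum>v\<in>V. card {e \<in> E. v \<in> e}) = 2 * card E"
proof -
  have "(\<Sum>v\<in>V. card {e \<in> E. v \<in> e}) = (\<Sum>e\<in>E. card {v \<in> V. v \<in> e})"
    using sum.swap_restrict[of V E "\<lambda>_ _. 1 :: nat" "\<lambda>v e. v \<in> e"] assms
      finite_graph_edges[OF assms]
    by (simp add: graph_def)
  also have "\<dots> = (\<Sum>e\<in>E. 2)"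
  proof (rule sum.cong)
    fix e assume "e \<in> E"
    with assms have "{v \<in> V. v \<in> e} = e" "card e = 2" by (auto simp: graph_def)
    then show "card {v \<in> V. v \<in> e} = 2" by simp
  qed simp
  finally show ?thesis by simp
qed

text \<open>Each incident edge is identified with its other endpoint. This connects the degrees that
  the algorithm computes with the neighbourhoods that the double count uses.\<close>

lemma card_incident_edges:
  assumes "graph V E"
  shows "card {e \<in> E. v \<in> e} = card {w \<in> V. {v, w} \<in> E}"
proof -
  have "{e \<in> E. v \<in> e} = (\<lambda>w. {v, w}) ` {w \<in> V. {v, w} \<in> E}" (is "?L = ?f ` ?W")
  proof
    show "?L \<subseteq> ?f ` ?W"
    proof
      fix e assume e: "e \<in> ?L"
      with assms have "card e = 2" "e \<subseteq> V" by (auto simp: graph_def)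
      then obtain a b where "e = {a, b}" by (auto simp: card_2_iff)
      with e \<open>e \<subseteq> V\<close> obtain w where "e = {v, w}" "w \<in> V" by fastforce
      with e show "e \<in> ?f ` ?W" by auto
    qed
  qed auto
  moreover have "inj_on ?f ?W" by (auto simp: inj_on_def doubleton_eq_iff)
  ultimately show ?thesis by (simp add: card_image)
qed

lemma card_edges_le:
  assumes "graph V E"
  shows "2 * card E \<le> (card V)\<^sup>2"
proof -
  have "2 * card E \<le> (\<Sum>v\<in>V. card V)"
    using assms unfolding sum_degrees[OF assms, symmetric] card_incident_edges[OF assms]
    by (intro sum_mono card_mono) (auto simp: graph_def)
  then show ?thesis by (simp add: power2_eq_square)
qed

section \<open>The parameters of FIND-BIPARTITE\<close>

text \<open>One term of the exponential series at \<open>q\<close> is below the whole sum. This is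
  the Stirling-type estimate behind \<open>r choose q \<le> (e * r / q) ^ q\<close>.\<close>

lemma power_self_le_fact_exp: "real q ^ q \<le> fact q * exp (real q)"
proof -
  have "(\<lambda>k. real q ^ k /\<^sub>R fact k) sums exp (real q)" by (rule exp_converges)
  then have "(\<Sum>k\<in>{q}. real q ^ k /\<^sub>R fact k) \<le> exp (real q)"
    by (intro sum_le_suminf[THEN order_trans]) (auto simp: sums_iff)
  then show ?thesis by (simp add: field_simps)
qed

lemma ln_le_two_sqrt: "0 < x \<Longrightarrow> ln x \<le> 2 * sqrt x"
  using ln_bound[of "sqrt x"] by (simp add: ln_sqrt)

text \<open>All bounds rest on \<open>y = 2 * e * n^2 / m\<close> lying between
  \<open>4 * e\<close>, from \<open>2 * m \<le> n^2\<close>, and \<open>n / 2\<close>, from the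
  density hypothesis. Then \<open>ln y \<ge> 1\<close>, and \<open>q\<close> is the floor of a
  quotient that is at least 1. The last bound is the source of \<open>r * n \<le> m\<close>.\<close>

lemma param_q_bounds:
  assumes n: "16 \<le> n" and m: "3 * real n powr (3 / 2) \<le> real m" "2 * m \<le> n\<^sup>2"
  defines "q \<equiv> param_q n m"
  shows "0 < q" "q \<le> n"
    and "ln (real n / 2) \<le> 2 * real q * ln (2 * exp 1 * (real n)\<^sup>2 / real m)"
    and "(2 * exp 1 * (real n)\<^sup>2 / real m) ^ q \<le> real n / 2"
    and "real q * real n ^ 3 \<le> (real m)\<^sup>2"
proof -
  let ?n = "real n" and ?m = "real m"
  define y where "y = 2 * exp 1 * ?n\<^sup>2 / ?m"
  have e: "exp 1 \<le> (3::real)" "2 \<le> exp (1::real)"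
    using exp_le exp_ge_add_one_self[of "1::real"] by auto
  have "?n powr (3 / 2) = ?n powr (1 + 1 / 2)" by simp
  also have "\<dots> = ?n * sqrt ?n" unfolding powr_add using n by (simp add: powr_half_sqrt)
  finally have m1: "3 * (?n * sqrt ?n) \<le> ?m" using m by simp
  \<comment> \<open>With \<open>sqrt n \<ge> 4\<close> the density hypothesis gives
    \<open>m \<ge> 12 * n\<close>, which is enough for \<open>4 * e * n \<le> m\<close> because
    \<open>e \<le> 3\<close>.\<close>
  have "sqrt 16 \<le> sqrt ?n" using n by (intro real_sqrt_le_mono) simp
  then have "4 \<le> sqrt ?n" by simp
  then have "?n * 4 \<le> ?n * sqrt ?n" by (intro mult_left_mono) auto
  then have m12: "12 * ?n \<le> ?m" using m1 by linarith
  have n0: "0 < ?n" and m0: "0 < ?m" using n m12 by auto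
  have m2: "2 * ?m \<le> ?n\<^sup>2" using m(2) by (metis of_nat_le_iff of_nat_mult of_nat_numeral of_nat_power)
  have y4: "4 * exp 1 \<le> y"
    unfolding y_def using m2 m0 by (simp add: field_simps)
  then have y8: "8 \<le> y" using e by linarith
  have "exp 1 * ?n \<le> 3 * ?n" using e n0 by simp
  then have "4 * (exp 1 * ?n) \<le> ?m" using m12 by linarith
  then have "4 * (exp 1 * ?n) * ?n \<le> ?m * ?n" using n0 by (intro mult_right_mono) auto
  then have yn: "y \<le> ?n / 2"
    unfolding y_def using m0 n0 by (simp add: field_simps power2_eq_square)
  have ln_y: "1 \<le> ln y"
    using y4 e y8 by (subst ln_ge_iff) linarith+
  define x where "x = ln (?n / 2) / ln y"
  have x1: "1 \<le> x" unfolding x_def using ln_y yn y8 by (simp add: field_simps)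
  have q_def': "q = nat \<lfloor>x\<rfloor>" by (simp add: q_def param_q_def x_def y_def)
  have qx: "real q \<le> x" "x < real q + 1" using x1 unfolding q_def' by linarith+
  show q0: "0 < q" using x1 unfolding q_def' by linarith
  \<comment> \<open>Rounding down a number that is at least 1 loses at most a factor 2.\<close>
  have "x \<le> 2 * real q" using qx q0 by linarith
  then show "ln (real n / 2) \<le> 2 * real q * ln (2 * exp 1 * (real n)\<^sup>2 / real m)"
    unfolding x_def y_def[symmetric] using ln_y by (simp add: field_simps)
  have ln_yq: "real q * ln y \<le> ln (?n / 2)"
    using qx(1) unfolding x_def using ln_y by (simp add: field_simps)
  then have "ln (y ^ q) \<le> ln (?n / 2)" using y8 by (simp add: ln_realpow)
  then have yq: "y ^ q \<le> ?n / 2" using y8 n0 by simp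
  then show "(2 * exp 1 * (real n)\<^sup>2 / real m) ^ q \<le> real n / 2" by (simp add: y_def)
  have "real q * 1 \<le> real q * ln y" using ln_y by (intro mult_left_mono) auto
  then have qln: "real q \<le> ln (?n / 2)" using ln_yq by linarith
  also have "\<dots> \<le> ?n / 2" using n0 by (intro ln_bound) simp
  finally show "q \<le> n" by linarith
  show "real q * ?n ^ 3 \<le> ?m\<^sup>2"
  \<comment> \<open>Up to 9 = 3^2 the square of the density hypothesis suffices. For larger
    \<open>q\<close>, \<open>y ^ 4 \<le> y ^ q \<le> n / 2\<close> forces
    \<open>m ^ 4 \<ge> 32 * n ^ 7\<close>, while \<open>q \<le> ln n\<close> is far smaller than
    what this allows.\<close>
  proof (cases "q \<le> 9")
    case True
    then have "real q * ?n ^ 3 \<le> 9 * ?n ^ 3" by (intro mult_right_mono) auto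
    also have "\<dots> = (3 * (?n * sqrt ?n))\<^sup>2"
      using n0 by (simp add: power_mult_distrib power2_eq_square power3_eq_cube)
    also have "\<dots> \<le> ?m\<^sup>2" using m1 n0 by (intro power_mono) auto
    finally show ?thesis .
  next
    case False
    have "y ^ 4 \<le> y ^ q" using False y8 by (intro power_increasing) auto
    moreover have "(2 * ?n\<^sup>2 / ?m) ^ 4 \<le> y ^ 4"
      unfolding y_def using e n0 m0 by (intro power_mono divide_right_mono mult_right_mono) auto
    ultimately have "(2 * ?n\<^sup>2 / ?m) ^ 4 \<le> ?n / 2" using yq by linarith
    then have "32 * ?n ^ 8 \<le> ?n * ?m ^ 4"
      using m0 by (simp add: power_divide power_mult_distrib field_simps flip: power_mult)
    moreover have "32 * ?n ^ 8 = ?n * (32 * ?n ^ 7)" by (simp add: eval_nat_numeral)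
    ultimately have "?n * (32 * ?n ^ 7) \<le> ?n * ?m ^ 4" by linarith
    then have mn: "32 * ?n ^ 7 \<le> ?m ^ 4" using n0 by simp
    have "real q \<le> ln ?n"
      using qln n0 by (smt (verit) field_sum_of_halves ln_mono)
    also have "\<dots> \<le> 2 * sqrt ?n" using n0 by (intro ln_le_two_sqrt)
    finally have "(real q)\<^sup>2 \<le> (2 * sqrt ?n)\<^sup>2" by (intro power_mono) auto
    then have "(real q)\<^sup>2 \<le> 4 * ?n" using n0 by (simp add: power_mult_distrib)
    then have "(real q)\<^sup>2 * ?n ^ 6 \<le> 4 * ?n * ?n ^ 6" by (intro mult_right_mono) auto
    also have "\<dots> = 4 * ?n ^ 7" by (simp add: eval_nat_numeral)
    also have "\<dots> \<le> 32 * ?n ^ 7" by simp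
    also note mn
    finally have "(real q * ?n ^ 3)\<^sup>2 \<le> (?m\<^sup>2)\<^sup>2"
      by (simp add: power_mult_distrib flip: power_mult)
    then show ?thesis by (rule power2_le_imp_le) simp
  qed
qed

text \<open>Here \<open>r\<close> is the floor of \<open>z = q * n^2 / m\<close>. The bound
  \<open>2 * q \<le> r\<close> keeps \<open>r choose j\<close> increasing up to
  \<open>j = q\<close>, \<open>r * n \<le> m\<close> controls adjacencies inside \<open>R\<close>,
  and the subtracted \<open>m\<close> in the fourth bound is the price of rounding.\<close>

lemma param_r_bounds:
  assumes n: "16 \<le> n" and m: "3 * real n powr (3 / 2) \<le> real m" "2 * m \<le> n\<^sup>2"
  defines "q \<equiv> param_q n m" and "r \<equiv> param_r n m"
  shows "2 * q \<le> r" "r \<le> n" "r * n \<le> m"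
    and "real q * (real n)\<^sup>2 - real m \<le> real r * real m"
    and "real (r choose q) * 2 ^ q \<le> real n / 2"
proof -
  let ?n = "real n" and ?m = "real m"
  note qb = param_q_bounds[OF n m, folded q_def]
  have n0: "0 < ?n" using n by simp
  then have "0 < ?n powr (3 / 2)" by simp
  then have m0: "0 < ?m" using m(1) by linarith
  have m2: "2 * ?m \<le> ?n\<^sup>2" using m(2) by (metis of_nat_le_iff of_nat_mult of_nat_numeral of_nat_power)
  define z where "z = real q * ?n\<^sup>2 / ?m"
  have r: "r = nat \<lfloor>z\<rfloor>" by (simp add: r_def param_r_def z_def q_def)
  have z0: "0 \<le> z" by (simp add: z_def)
  have rz: "real r \<le> z" "z < real r + 1" using z0 unfolding r by linarith+
  have "real q * (2 * ?m) \<le> real q * ?n\<^sup>2" using m2 by (intro mult_left_mono) auto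
  then have "2 * real q \<le> z" unfolding z_def using m0 by (simp add: field_simps)
  then show "2 * q \<le> r" using rz(2) by linarith
  have "z * ?n * ?m = real q * ?n ^ 3"
    using m0 by (simp add: z_def power2_eq_square power3_eq_cube)
  also have "\<dots> \<le> ?m * ?m" using qb(5) by (simp add: power2_eq_square)
  finally have "z * ?n \<le> ?m" using m0 by simp
  moreover have "real r * ?n \<le> z * ?n" using rz n0 by (intro mult_right_mono) auto
  ultimately have rn: "real r * ?n \<le> ?m" by linarith
  then show rn': "r * n \<le> m" by (metis of_nat_le_iff of_nat_mult)
  have "r * n \<le> n * n" using rn' m(2) unfolding power2_eq_square by linarith
  then show "r \<le> n" using n by simp
  have "z * ?m \<le> (real r + 1) * ?m" using rz m0 by (intro mult_right_mono) auto
  then show "real q * (real n)\<^sup>2 - real m \<le> real r * real m"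
    unfolding z_def using m0 by (simp add: algebra_simps)
  \<comment> \<open>\<open>r choose q\<close> is at most \<open>z ^ q / fact q\<close>, hence at
    most \<open>(e * n^2 / m) ^ q\<close>; the extra \<open>2 ^ q\<close> completes this to the
    power that the choice of \<open>q\<close> keeps below \<open>n / 2\<close>.\<close>
  have "real (r choose q) * fact q \<le> real r ^ q"
    using binomial_fact_pow[of r q] by (metis of_nat_fact of_nat_le_iff of_nat_mult of_nat_power)
  also have "\<dots> \<le> z ^ q" using rz by (intro power_mono) auto
  also have "\<dots> = real q ^ q * (?n\<^sup>2 / ?m) ^ q" by (simp add: z_def flip: power_mult_distrib)
  also have "\<dots> \<le> fact q * exp (real q) * (?n\<^sup>2 / ?m) ^ q"
    by (intro mult_right_mono power_self_le_fact_exp) auto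
  finally have "real (r choose q) \<le> exp (real q) * (?n\<^sup>2 / ?m) ^ q"
    by (simp add: mult.assoc mult.commute[of _ "fact q"])
  then have "real (r choose q) * 2 ^ q \<le> exp (real q) * (?n\<^sup>2 / ?m) ^ q * 2 ^ q" by simp
  also have "exp (real q) = exp 1 ^ q" by (simp flip: exp_of_nat_mult)
  also have "exp 1 ^ q * (?n\<^sup>2 / ?m) ^ q * 2 ^ q = (2 * exp 1 * ?n\<^sup>2 / ?m) ^ q"
    by (simp add: mult_ac flip: power_mult_distrib)
  finally show "real (r choose q) * 2 ^ q \<le> real n / 2" using qb(4) by linarith
qed

section \<open>Correctness of FIND-BIPARTITE\<close>

lemma length_eq_card_if_represents:
  assumes "represents vs es V E"
  shows "length vs = card V" "length es = card E"
proof -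
  from assms show "length vs = card V" by (auto simp: represents_def distinct_card)
  have "length (map edge_of es) = card E"
    using assms by (metis represents_def distinct_card)
  then show "length es = card E" by simp
qed

text \<open>Tagging, sorting and untagging only permutes \<open>vs\<close>, so multisets transfer
  distinctness and membership; the degree comparison is sortedness across the cut at position
  \<open>r\<close>.\<close>

lemma highest_degree_t_correct:
  fixes vs :: "'a list" and es :: "('a \<times> 'a) list" and r :: nat
  assumes "distinct vs"
  defines "R \<equiv> result (highest_degree_t r vs es)"
  shows "distinct R" "set R \<subseteq> set vs" "length R = min r (length vs)"
    and "v \<in> set R \<Longrightarrow> w \<in> set vs - set R \<Longrightarrow> result (degree_t es w) \<le> result (degree_t es v)"
proof -
  define ss where "ss = result (sort_desc_t (map (\<lambda>v. (result (degree_t es v), v)) vs))"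
  have R: "R = take r (map snd ss)"
    by (simp add: R_def highest_degree_t_def ss_def take_map)
  have mset_ss: "mset ss = mset (map (\<lambda>v. (result (degree_t es v), v)) vs)"
    by (simp add: ss_def)
  then have "mset (map snd ss) = mset vs"
    unfolding mset_map by (simp add: image_mset.compositionality o_def)
  then have dist: "distinct (map snd ss)" and set: "set (map snd ss) = set vs"
    and len: "length ss = length vs"
    using assms(1) by (metis distinct_count_atmost_1 mset_eq_setD, metis mset_eq_setD,
        metis length_map mset_eq_length)
  show "distinct R" using dist unfolding R by (rule distinct_take)
  show "set R \<subseteq> set vs" unfolding R set[symmetric] by (rule set_take_subset)
  show "length R = min r (length vs)" using len by (simp add: R min.commute)
  assume v: "v \<in> set R" and w: "w \<in> set vs - set R"
  have deg: "fst p = result (degree_t es (snd p))" if "p \<in> set ss" for p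
    using mset_eq_setD[OF mset_ss] that by auto
  have "sorted_wrt (\<lambda>p s. fst s \<le> fst p) (take r ss @ drop r ss)"
    using sorted_sort_desc_t unfolding ss_def by simp
  moreover obtain p where p: "p \<in> set (take r ss)" "v = snd p"
    using v by (auto simp: R take_map)
  moreover have "w \<in> snd ` (set (take r ss) \<union> set (drop r ss))"
    using w set by (metis Diff_iff append_take_drop_id list.set_map set_append)
  then obtain s where s: "s \<in> set (drop r ss)" "w = snd s"
    using w by (auto simp: R take_map)
  ultimately have "fst s \<le> fst p" unfolding sorted_wrt_append by blast
  then show "result (degree_t es w) \<le> result (degree_t es v)"
    using deg p s by (metis in_set_dropD in_set_takeD)
qed

lemma steps_highest_degree_t:
  "steps (highest_degree_t r vs es)
     \<le> (3 * length es + 4) * length vs + length vs * length vs + 5 * length vs + 4"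
proof -
  let ?n = "length vs"
  define ps where "ps = map (\<lambda>v. (result (degree_t es v), v)) vs"
  define ss where "ss = result (sort_desc_t ps)"
  have "steps (map_t (\<lambda>v. bind_timed (degree_t es v) (\<lambda>d. ret (d, v))) vs)
      \<le> (3 * length es + 3 + 1) * ?n + 1"
    by (rule steps_map_t) (use steps_degree_t[of es] in \<open>simp add: le_diff_conv\<close>)
  moreover have "steps (sort_desc_t ps) \<le> ?n * (?n + 2) + 1"
    using steps_sort_desc_t[of ps] by (simp add: ps_def)
  moreover have "steps (take_t r ss) \<le> ?n + 1"
    using steps_take_t[of r ss] by (simp add: ss_def ps_def)
  moreover have "steps (map_t (\<lambda>p. ret (snd p)) (take r ss)) \<le> 2 * ?n + 1"
  proof -
    have "steps (map_t (\<lambda>p. ret (snd p)) (take r ss)) \<le> (1 + 1) * length (take r ss) + 1"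
      by (rule steps_map_t) simp
    then show ?thesis by (simp add: ss_def ps_def)
  qed
  moreover have "steps (highest_degree_t r vs es)
      = steps (map_t (\<lambda>v. bind_timed (degree_t es v) (\<lambda>d. ret (d, v))) vs)
        + steps (sort_desc_t ps) + steps (take_t r ss)
        + steps (map_t (\<lambda>p. ret (snd p)) (take r ss))"
    by (simp add: highest_degree_t_def ss_def ps_def)
  ultimately show ?thesis by (simp add: algebra_simps)
qed

lemma result_common_nbrs_t:
  "result (common_nbrs_t vs es R C)
     = filter (\<lambda>w. w \<notin> set R \<and> (\<forall>v\<in>set C. {v, w} \<in> set (map edge_of es))) vs"
  by (simp add: common_nbrs_t_def result_adjacent_t)

lemma steps_common_nbrs_t:
  "steps (common_nbrs_t vs es R C)
     \<le> (2 * length R + (2 * length es + 2) * length C + 4) * length vs + 1"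
proof -
  have "steps (all_t (\<lambda>v. adjacent_t es v w) C) \<le> (2 * length es + 1 + 1) * length C + 1" for w
    by (intro steps_all_t steps_adjacent_t)
  then have all: "steps (all_t (\<lambda>v. adjacent_t es v w) C) \<le> (2 * length es + 2) * length C + 1" for w
    by simp
  have step: "steps (member_t w R) + (steps (all_t (\<lambda>v. adjacent_t es v w) C) + 1)
    \<le> 2 * length R + (2 * length es + 2) * length C + 3" for w
    using steps_member_t[of w R] all[of w] by linarith
  have "steps (common_nbrs_t vs es R C)
      \<le> (2 * length R + (2 * length es + 2) * length C + 3 + 1) * length vs + 1"
    unfolding common_nbrs_t_def
    by (intro steps_filter_t) (simp only: steps_bind_timed steps_ret step)
  then show ?thesis by (simp add: ac_simps)
qed

lemma search_t_Some:
  assumes "result (search_t q vs es R Cs) = Some (C, D)"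
  shows "C \<in> set Cs" "D = take q (result (common_nbrs_t vs es R C))"
    "q \<le> length (result (common_nbrs_t vs es R C))"
  using assms by (induction Cs) (auto split: if_splits)

lemma search_t_None:
  assumes "result (search_t q vs es R Cs) = None" "C \<in> set Cs"
  shows "length (result (common_nbrs_t vs es R C)) < q"
  using assms by (induction Cs) (auto split: if_splits)

lemma steps_search_t:
  assumes "length R \<le> length vs" and "\<And>C. C \<in> set Cs \<Longrightarrow> length C \<le> length vs"
  shows "steps (search_t q vs es R Cs)
    \<le> length Cs * ((2 * length es + 8) * length vs * length vs + 6 * length vs + 4) + 1"
  using assms(2)
proof (induction Cs)
  case (Cons C Cs)
  let ?n = "length vs" and ?m = "length es"
  let ?D = "result (common_nbrs_t vs es R C)"
  have "(2 * length R + (2 * ?m + 2) * length C + 4) * ?n + 1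
      \<le> (2 * ?n + (2 * ?m + 2) * ?n + 4) * ?n + 1"
    using assms(1) Cons.prems by (intro add_mono mult_mono) auto
  with steps_common_nbrs_t[of vs es R C]
  have cn: "steps (common_nbrs_t vs es R C) \<le> (2 * ?n + (2 * ?m + 2) * ?n + 4) * ?n + 1"
    by (rule order_trans)
  have D: "length ?D \<le> ?n" by (simp add: result_common_nbrs_t)
  have take: "steps (take_t q ?D) \<le> ?n + 1" using steps_take_t[of q ?D] D by linarith
  have IH: "steps (search_t q vs es R Cs)
    \<le> length Cs * ((2 * ?m + 8) * ?n * ?n + 6 * ?n + 4) + 1"
    using Cons by simp
  have "steps (search_t q vs es R (C # Cs))
      \<le> steps (common_nbrs_t vs es R C) + (length ?D + 1) + steps (take_t q ?D) + 1
        + steps (search_t q vs es R Cs)"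
    by simp
  also have "\<dots> \<le> (2 * ?n + (2 * ?m + 2) * ?n + 4) * ?n + 1 + (?n + 1) + (?n + 1) + 1
      + (length Cs * ((2 * ?m + 8) * ?n * ?n + 6 * ?n + 4) + 1)"
    using cn D take IH by (intro add_mono) auto
  finally show ?case by (simp add: algebra_simps)
qed simp

lemma distinct_combinations_t:
  assumes "distinct R" "C \<in> set (result (combinations_t q R))"
  shows "distinct C" "set C \<subseteq> set R" "length C = q"
  using assms subseqs_powset[of R] by (auto dest: subseqs_distinctD simp del: in_set_subseqs)

lemma set_combinations_t:
  assumes "distinct R" "S \<subseteq> set R" "card S = q"
  shows "\<exists>C\<in>set (result (combinations_t q R)). set C = S"
proof -
  obtain C where C: "C \<in> set (subseqs R)" "set C = S" using subset_subseqs[OF assms(2)] by auto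
  then have "length C = q" using assms subseqs_distinctD distinct_card by metis
  with C show ?thesis by auto
qed

text \<open>The counting argument, kept free of lists and steps. It provides a subset that the
  search would accept, though the search may stop at an earlier one.\<close>

lemma high_degree_biclique_exists:
  assumes "graph V E" and n: "16 \<le> card V"
    and m: "3 * real (card V) powr (3 / 2) \<le> real (card E)"
    and R: "R \<subseteq> V" "card R = param_r (card V) (card E)"
    and top: "\<And>v w. v \<in> R \<Longrightarrow> w \<in> V - R \<Longrightarrow> card {e \<in> E. w \<in> e} \<le> card {e \<in> E. v \<in> e}"
  shows "\<exists>C\<subseteq>R. card C = param_q (card V) (card E) \<and>
    param_q (card V) (card E) \<le> card {w \<in> V - R. \<forall>v\<in>C. {v, w} \<in> E}"
proof (rule ccontr)
  define q r n m where "q = param_q (card V) (card E)" and "r = param_r (card V) (card E)"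
    and "n = real (card V)" and "m = real (card E)"
  let ?W = "V - R"
  assume "\<not> ?thesis"
  then have no: "\<And>C. C \<subseteq> R \<Longrightarrow> card C = q \<Longrightarrow> card {w \<in> ?W. \<forall>v\<in>C. {v, w} \<in> E} < q"
    unfolding q_def by (meson not_le)
  note bounds = param_q_bounds[OF n m card_edges_le[OF assms(1)], folded q_def r_def n_def m_def]
    param_r_bounds[OF n m card_edges_le[OF assms(1)], folded q_def r_def n_def m_def]
  have fin: "finite V" using assms(1) by (simp add: graph_def)
  have finR: "finite R" using fin R(1) by (rule rev_finite_subset)
  have n0: "16 \<le> n" using n by (simp add: n_def)
  define e where "e = (\<Sum>v\<in>R. card {w \<in> ?W. {v, w} \<in> E})"
  \<comment> \<open>A vertex of \<open>R\<close> has at most \<open>r\<close> neighbours inside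
    \<open>R\<close>, so restricting to \<open>V - R\<close> costs at most \<open>r * r\<close> in
    total.\<close>
  have "(\<Sum>v\<in>R. card {e \<in> E. v \<in> e}) \<le> (\<Sum>v\<in>R. card {w \<in> ?W. {v, w} \<in> E} + r)"
  proof (rule sum_mono)
    fix v
    have "card {w \<in> V. {v, w} \<in> E} \<le> card ({w \<in> ?W. {v, w} \<in> E} \<union> R)"
      using fin finR by (intro card_mono) auto
    also have "\<dots> \<le> card {w \<in> ?W. {v, w} \<in> E} + card R" by (rule card_Un_le)
    finally show "card {e \<in> E. v \<in> e} \<le> card {w \<in> ?W. {v, w} \<in> E} + r"
      using R(2) by (simp add: card_incident_edges[OF assms(1)] r_def)
  qed
  also have "\<dots> = e + r * r" using R(2) by (simp add: sum.distrib e_def r_def)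
  finally have "card V * (\<Sum>v\<in>R. card {e \<in> E. v \<in> e}) \<le> card V * (e + r * r)" by simp
  with card_mult_sum_le_top[where f = "\<lambda>v. card {e \<in> E. v \<in> e}", OF fin R(1) top]
  have "r * (2 * card E) \<le> card V * (e + r * r)"
    unfolding sum_degrees[OF assms(1)] R(2) r_def by linarith
  then have "real (r * (2 * card E)) \<le> real (card V * (e + r * r))" by (simp only: of_nat_le_iff)
  then have "2 * (real r * m) \<le> n * real e + real r * (real r * n)"
    by (simp add: n_def m_def algebra_simps)
  \<comment> \<open>Half of the \<open>2 * r * m\<close> available pays for the adjacencies inside
    \<open>R\<close>.\<close>
  moreover have "real r * (real r * n) \<le> real r * m"
    using bounds(8) by (intro mult_left_mono) (simp_all add: n_def m_def flip: of_nat_mult)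
  \<comment> \<open>Turns the rounding loss \<open>m\<close> into \<open>n^2 / 2\<close>, the origin
    of the \<open>1/2\<close> in \<open>q - 1/2\<close>.\<close>
  moreover have "2 * m \<le> n\<^sup>2"
    using card_edges_le[OF assms(1)] unfolding n_def m_def
    by (metis of_nat_le_iff of_nat_mult of_nat_numeral of_nat_power)
  ultimately have "real q * n\<^sup>2 - n\<^sup>2 / 2 \<le> n * real e" using bounds(9) by linarith
  then have "n * (real q * n - n / 2) \<le> n * real e" by (simp add: algebra_simps power2_eq_square)
  then have e_ge: "real q * n - n / 2 \<le> real e" using n0 by simp
  have "e \<le> (q - 1) * ((r choose q) + card ?W)"
    using sum_degrees_le_if_no_biclique[where P = "\<lambda>v w. {v, w} \<in> E" and W = ?W,
        OF finR finite_Diff[OF fin] bounds(1) no]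
    unfolding e_def R(2) r_def .
  also have "\<dots> \<le> (q - 1) * ((r choose q) + card V)"
    using fin by (intro mult_left_mono add_left_mono card_mono) auto
  finally have "real e \<le> real ((q - 1) * ((r choose q) + card V))" by (simp only: of_nat_le_iff)
  also have "\<dots> = (real q - 1) * real (r choose q) + (real q - 1) * n"
    unfolding of_nat_mult of_nat_add of_nat_diff[OF Suc_leI[OF bounds(1), folded One_nat_def]]
    by (simp add: n_def algebra_simps)
  finally have "n / 2 \<le> (real q - 1) * real (r choose q)"
    using e_ge by (simp add: algebra_simps)
  moreover have "(real q - 1) * real (r choose q) < n / 2"
  proof -
    have "r choose q > 0" using bounds(6) by (simp add: zero_less_binomial)
    \<comment> \<open>Here the factor 2 inside the logarithm that defines \<open>q\<close> is
      spent.\<close>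
    moreover have "real q - 1 < 2 ^ q" using of_nat_less_two_power[of q, where 'a = real] by linarith
    ultimately have "(real q - 1) * real (r choose q) < 2 ^ q * real (r choose q)"
      by (intro mult_strict_right_mono) auto
    then show ?thesis using bounds(10) by (simp add: mult.commute)
  qed
  ultimately show False by linarith
qed

text \<open>List lengths are recorded next to cardinalities because the cost of deleting the edges
  is measured on the lists.\<close>

lemma find_bipartite_correct:
  assumes G: "graph V E" and rep: "represents vs es V E" and n: "16 \<le> card V"
    and m: "3 * real (card V) powr (3 / 2) \<le> real (card E)"
  defines "q \<equiv> param_q (card V) (card E)"
  shows "\<exists>C D. result (find_bipartite vs es) = Some (C, D) \<and>
    complete_bipartite_subgraph V E (set C, set D) \<and> card (set C) = q \<and> card (set D) = q \<and>
    length C = q \<and> length D = q"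
proof -
  define r where "r = param_r (card V) (card E)"
  have vs: "distinct vs" "set vs = V" and es: "distinct (map edge_of es)" "set (map edge_of es) = E"
    using rep by (auto simp: represents_def)
  note len = length_eq_card_if_represents[OF rep]
  define R where "R = result (highest_degree_t r vs es)"
  have "r \<le> card V"
    using param_r_bounds(2)[OF n m card_edges_le[OF G]] by (simp add: r_def)
  with highest_degree_t_correct[OF vs(1), where r = r and es = es]
  have R: "distinct R" "set R \<subseteq> V" "length R = r"
    and top: "\<And>v w. v \<in> set R \<Longrightarrow> w \<in> V - set R \<Longrightarrow> card {e \<in> E. w \<in> e} \<le> card {e \<in> E. v \<in> e}"
    unfolding R_def[symmetric] result_degree_t[OF es(1)] es(2) by (simp_all add: vs(2) len)
  have fb: "result (find_bipartite vs es) = result (search_t q vs es R (result (combinations_t q R)))"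
    by (simp add: find_bipartite_def len q_def R_def r_def)
  have cn: "result (common_nbrs_t vs es R C) = filter (\<lambda>w. w \<notin> set R \<and> (\<forall>v\<in>set C. {v, w} \<in> E)) vs" for C
    by (simp only: result_common_nbrs_t es)
  have cn_set: "set (result (common_nbrs_t vs es R C)) = {w \<in> V - set R. \<forall>v\<in>set C. {v, w} \<in> E}"
    and cn_dist: "distinct (result (common_nbrs_t vs es R C))" for C
    unfolding cn using vs by auto
  have "result (find_bipartite vs es) \<noteq> None"
  proof
    assume None: "result (find_bipartite vs es) = None"
    have "card (set R) = r" using R distinct_card by blast
    then obtain S where S: "S \<subseteq> set R" "card S = q"
        "q \<le> card {w \<in> V - set R. \<forall>v\<in>S. {v, w} \<in> E}"
      using high_degree_biclique_exists[OF G n m R(2) _ top] by (auto simp: r_def q_def)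
    then obtain C where C: "C \<in> set (result (combinations_t q R))" "set C = S"
      using set_combinations_t[OF R(1)] by blast
    have "length (result (common_nbrs_t vs es R C)) < q"
      using search_t_None[OF None[unfolded fb] C(1)] .
    then have "card {w \<in> V - set R. \<forall>v\<in>set C. {v, w} \<in> E} < q"
      unfolding cn_set[symmetric] distinct_card[OF cn_dist] .
    then show False using S(3) C(2) by simp
  qed
  then obtain C D where CD: "result (find_bipartite vs es) = Some (C, D)"
    by (metis not_None_eq surj_pair)
  note s = search_t_Some[OF CD[unfolded fb]]
  note C = distinct_combinations_t[OF R(1) s(1)]
  have D: "distinct D" "length D = q" using s(2,3) cn_dist[of C] by auto
  have "set D \<subseteq> {w \<in> V - set R. \<forall>v\<in>set C. {v, w} \<in> E}"
    unfolding s(2) cn_set[symmetric] by (rule set_take_subset)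
  then have "complete_bipartite_subgraph V E (set C, set D)"
    using C R(2) by (auto simp: complete_bipartite_subgraph_def cross_edges_def)
  then show ?thesis using CD C D by (metis distinct_card)
qed

section \<open>Running time of FIND-BIPARTITE\<close>

definition find_bipartite_bound :: "nat \<Rightarrow> nat \<Rightarrow> nat" where
  "find_bipartite_bound n m = n + m + 4 + ((3 * m + 4) * n + n * n + 5 * n + 4)
     + 6 * (n + 1) * ((n + 1) * n) + (n * ((2 * m + 8) * n * n + 6 * n + 4) + 1)"

lemma find_bipartite_bound_mono: "m \<le> m' \<Longrightarrow> find_bipartite_bound n m \<le> find_bipartite_bound n m'"
  unfolding find_bipartite_bound_def by (intro add_mono mult_mono) auto

text \<open>Although \<open>q\<close> may grow with \<open>n\<close>, dropping \<open>2 ^ q\<close>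
  from the bound on \<open>r choose q\<close> leaves at most \<open>n\<close> subsets to be
  tried.\<close>

lemma steps_find_bipartite:
  assumes G: "graph V E" and rep: "represents vs es V E" and n: "16 \<le> card V"
    and m: "3 * real (card V) powr (3 / 2) \<le> real (card E)"
  shows "steps (find_bipartite vs es) \<le> find_bipartite_bound (card V) (card E)"
proof -
  define q r where "q = param_q (card V) (card E)" and "r = param_r (card V) (card E)"
  note len = length_eq_card_if_represents[OF rep]
  note bounds = param_q_bounds(2)[OF n m card_edges_le[OF G], folded q_def r_def]
    param_r_bounds[OF n m card_edges_le[OF G], folded q_def r_def]
  have vs: "distinct vs" using rep by (simp add: represents_def)
  define R where "R = result (highest_degree_t r vs es)"
  define Cs where "Cs = result (combinations_t q R)"
  have R: "distinct R" "length R = r"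
    using highest_degree_t_correct[OF vs, where r = r and es = es] bounds(3)
    by (auto simp: R_def len)
  have "real (r choose q) * 1 \<le> real (r choose q) * 2 ^ q" by (intro mult_left_mono) auto
  then have "real (r choose q) \<le> real (card V)" using bounds(6) by linarith
  then have choose: "r choose q \<le> card V" by simp
  \<comment> \<open>\<open>2 * q \<le> r\<close> places all \<open>j \<le> q\<close> on the
    increasing half of the binomial row.\<close>
  have "(\<Sum>j\<le>q. r choose j) \<le> (\<Sum>j\<le>q. r choose q)"
    using bounds(2) by (intro sum_mono binomial_mono) auto
  also have "\<dots> = (q + 1) * (r choose q)" by simp
  also have "\<dots> \<le> (card V + 1) * card V" using choose bounds(1) by (intro mult_mono) auto
  finally have sum: "(\<Sum>j\<le>q. r choose j) \<le> (card V + 1) * card V" .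
  have "6 * (r + 1) * (\<Sum>j\<le>q. r choose j) \<le> 6 * (card V + 1) * ((card V + 1) * card V)"
    using sum bounds(3) by (intro mult_mono) auto
  then have 1: "steps (combinations_t q R) \<le> 6 * (card V + 1) * ((card V + 1) * card V)"
    using steps_combinations_t[of q R] R(2) by simp
  have "length C \<le> length vs" if "C \<in> set Cs" for C
    using distinct_combinations_t(3)[OF R(1)] that bounds(1) unfolding Cs_def len by metis
  moreover have "length R \<le> length vs" using R(2) bounds(3) len by simp
  ultimately have "steps (search_t q vs es R Cs) \<le> length Cs * ((2 * length es + 8) * length vs * length vs
      + 6 * length vs + 4) + 1"
    by (intro steps_search_t)
  also have "\<dots> \<le> card V * ((2 * card E + 8) * card V * card V + 6 * card V + 4) + 1"
  proof -
    have "length Cs \<le> card V" using choose by (simp only: Cs_def length_combinations_t R(2))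
    then show ?thesis unfolding len by (intro add_mono mult_right_mono) auto
  qed
  finally have 2: "steps (search_t q vs es R Cs)
    \<le> card V * ((2 * card E + 8) * card V * card V + 6 * card V + 4) + 1" .
  have "steps (find_bipartite vs es) = card V + card E + 4 + steps (highest_degree_t r vs es)
      + steps (combinations_t q R) + steps (search_t q vs es R Cs)"
    by (simp add: find_bipartite_def len q_def r_def R_def Cs_def)
  then show ?thesis
    using steps_highest_degree_t[of r vs es] 1 2 unfolding find_bipartite_bound_def len by linarith
qed

section \<open>Decompositions\<close>

lemma doubleton_mem_cross_edges:
  "{u, v} \<in> cross_edges (A, B) \<longleftrightarrow> u \<in> A \<and> v \<in> B \<or> v \<in> A \<and> u \<in> B"
  by (auto simp: cross_edges_def doubleton_eq_iff)

text \<open>Disjoint sides make \<open>(a, b)\<close> recoverable from \<open>{a, b}\<close>. This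
  gives the exact number of edges lost per round.\<close>

lemma card_cross_edges:
  assumes "A \<inter> B = {}"
  shows "card (cross_edges (A, B)) = card A * card B"
proof -
  have "cross_edges (A, B) = (\<lambda>(a, b). {a, b}) ` (A \<times> B)" by (auto simp: cross_edges_def)
  moreover have "inj_on (\<lambda>(a, b). {a, b}) (A \<times> B)"
    using assms by (auto simp: inj_on_def doubleton_eq_iff)
  ultimately show ?thesis by (simp add: card_image card_cartesian_product)
qed

lemma decomposition_append:
  assumes "decomposition V E Gs" "decomposition V E' Gs'" "E \<inter> E' = {}"
  shows "decomposition V (E \<union> E') (Gs @ Gs')"
proof -
  have "\<Union> (set (map cross_edges Gs)) = E" "{} \<notin> set (map cross_edges Gs)"
    "\<Union> (set (map cross_edges Gs')) = E'"
    using assms by (auto simp: decomposition_def partition_on_def)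
  \<comment> \<open>A common block would be a nonempty set of edges contained in both
    \<open>E\<close> and \<open>E'\<close>.\<close>
  then have "set (map cross_edges Gs) \<inter> set (map cross_edges Gs') = {}"
    using assms(3) by (auto simp: disjoint_iff)
  moreover have "partition_on (E \<union> E') (set (map cross_edges Gs) \<union> set (map cross_edges Gs'))"
    using assms unfolding decomposition_def partition_on_def
    by (auto intro!: disjoint_union simp del: set_map)
  ultimately show ?thesis
    using assms(1,2)
    by (auto simp: decomposition_def complete_bipartite_subgraph_def)
qed

lemma decomposition_singleton:
  assumes "complete_bipartite_subgraph V E G" "cross_edges G \<noteq> {}"
  shows "decomposition V (cross_edges G) [G]"
  using assms by (auto simp: decomposition_def complete_bipartite_subgraph_def partition_on_space)

lemma decomposition_Nil: "decomposition V {} []"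
  by (simp add: decomposition_def partition_on_empty)

lemma decomposition_single_edges:
  assumes "graph V (set (map edge_of es))" "distinct (map edge_of es)"
  shows "decomposition V (set (map edge_of es)) (map part_sets (map (\<lambda>(u, v). ([u], [v])) es))"
    (is "decomposition V ?E ?Gs")
proof -
  have cross: "cross_edges (part_sets (case e of (u, v) \<Rightarrow> ([u], [v]))) = {edge_of e}" for e :: "'a \<times> 'a"
    by (auto simp: cross_edges_def part_sets_def edge_of_def split: prod.split)
  have map: "map cross_edges ?Gs = map (\<lambda>x. {x}) (map edge_of es)" by (simp add: cross)
  have "complete_bipartite_subgraph V ?E (part_sets (case e of (u, v) \<Rightarrow> ([u], [v])))"
    if "e \<in> set es" for e
  proof -
    obtain u v where e: "e = (u, v)" by (cases e)
    have "edge_of e \<subseteq> V" "card (edge_of e) = 2" using assms(1) that by (auto simp: graph_def)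
    then have "u \<in> V" "v \<in> V" "u \<noteq> v" by (auto simp: e edge_of_def)
    then show ?thesis
      using that cross[of e]
      by (auto simp: complete_bipartite_subgraph_def part_sets_def e)
  qed
  moreover have "distinct (map cross_edges ?Gs)"
    unfolding map using assms(2) by (subst distinct_map) (auto simp: inj_on_def)
  moreover have "partition_on ?E (set (map cross_edges ?Gs))"
    unfolding map by (auto simp: partition_on_def disjoint_def)
  ultimately show ?thesis by (auto simp: decomposition_def)
qed

lemma complexity_Cons [simp]: "complexity ((A, B) # Gs) = card A + card B + complexity Gs"
  by (simp add: complexity_def)

lemma complexity_append [simp]: "complexity (Gs @ Gs') = complexity Gs + complexity Gs'"
  by (simp add: complexity_def)

lemma complexity_Nil [simp]: "complexity [] = 0"
  by (simp add: complexity_def)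

lemma complexity_single_edges:
  "complexity (map part_sets (map (\<lambda>(u, v). ([u], [v])) es)) = 2 * length es"
  by (induction es) (auto simp: part_sets_def)

lemma result_covers_t: "result (covers_t e G) \<longleftrightarrow> edge_of e \<in> cross_edges (part_sets G)"
  by (cases e; cases G) (auto simp: covers_t_def edge_of_def part_sets_def doubleton_mem_cross_edges)

lemma steps_covers_t: "steps (covers_t e (A, B)) \<le> 4 * length A + 4 * length B + 5"
proof -
  obtain u v where e: "e = (u, v)" by (cases e)
  show ?thesis
    using steps_member_t[of u A] steps_member_t[of v B] steps_member_t[of v A] steps_member_t[of u B]
    by (simp add: covers_t_def e)
qed

lemma result_delete_edges_t:
  "result (delete_edges_t G es) = filter (\<lambda>e. edge_of e \<notin> cross_edges (part_sets G)) es"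
  by (simp add: delete_edges_t_def result_covers_t)

lemma represents_delete_edges_t:
  assumes "represents vs es V E"
  shows "represents vs (result (delete_edges_t G es)) V (E - cross_edges (part_sets G))"
  using assms by (auto simp: represents_def result_delete_edges_t distinct_map_filter)

lemma steps_delete_edges_t:
  assumes "length A \<le> n" "length B \<le> n"
  shows "steps (delete_edges_t (A, B) es) \<le> (8 * n + 7) * length es + 1"
proof -
  have "steps (delete_edges_t (A, B) es) \<le> (8 * n + 6 + 1) * length es + 1"
    unfolding delete_edges_t_def
  proof (rule steps_filter_t)
    fix e
    show "steps (bind_timed (covers_t e (A, B)) (\<lambda>b. ret (\<not> b))) \<le> 8 * n + 6"
      using steps_covers_t[of e A B] assms by simp
  qed
  then show ?thesis by (simp add: algebra_simps)
qed

section \<open>The peeling loop\<close>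

text \<open>
  The integral of \<open>ln (2 e n\<^sup>2 / t)\<close> over \<open>0 \<le> t \<le> x\<close>. Up to the factor \<open>4 / ln (n / 2)\<close> the
  integrand bounds the cost \<open>2 / q\<close> that a \<open>K\<^bsub>q,q\<^esub>\<close> found in a graph with \<open>t\<close> edges incurs per edge.
\<close>
definition peel_potential :: "real \<Rightarrow> real \<Rightarrow> real" where
  "peel_potential n x = x * ln (2 * exp 1 * n\<^sup>2 / x) + x"

text \<open>The potential is concave in \<open>x\<close> with derivative
  \<open>ln (2 * e * n^2 / x)\<close>, so it lies below its tangent at \<open>x\<close>. This bounds
  the charge for \<open>k\<close> deleted edges by the drop in potential.\<close>

lemma peel_potential_diff:
  assumes "0 < n" "0 \<le> k" "k \<le> x" "0 < x"
  shows "peel_potential n (x - k) + k * ln (2 * exp 1 * n\<^sup>2 / x) \<le> peel_potential n x"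
\<comment> \<open>At \<open>k = x\<close> the tangent argument would meet \<open>ln 0\<close>; the
  potential vanishes there because of its factor \<open>x\<close>.\<close>
proof (cases "k = x")
  case False
  define y where "y = x - k"
  define L where "L = ln (2 * exp 1 * n\<^sup>2)"
  have y: "0 < y" "k = x - y" using False assms by (auto simp: y_def)
  have ln: "ln (2 * exp 1 * n\<^sup>2 / z) = L - ln z" if "0 < z" for z
    unfolding L_def using assms that by (subst ln_div) auto
  have "ln x - ln y \<le> x / y - 1"
    using ln_le_minus_one[of "x / y"] y assms by (simp add: ln_div)
  then have "y * (ln x - ln y) \<le> y * (x / y - 1)" using y by (intro mult_left_mono) auto
  also have "\<dots> = x - y" using y by (simp add: algebra_simps)
  finally show ?thesis
    using y assms(4) unfolding peel_potential_def y_def[symmetric] ln[OF y(1)] ln[OF assms(4)]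
    unfolding y(2) by (simp add: algebra_simps)
qed (use assms in \<open>simp add: peel_potential_def\<close>)

text \<open>\<open>ln t \<le> t - 1\<close> at \<open>t = 2 * e * n^2 / x\<close> produces a
  \<open>- x\<close> that cancels the second summand; 6 comes from \<open>e \<le> 3\<close>.\<close>

lemma peel_potential_le:
  assumes "0 < n" "0 \<le> x"
  shows "peel_potential n x \<le> 6 * n\<^sup>2"
proof (cases "x = 0")
  case False
  have "x * ln (2 * exp 1 * n\<^sup>2 / x) \<le> x * (2 * exp 1 * n\<^sup>2 / x - 1)"
    using False assms by (intro mult_left_mono ln_le_minus_one) auto
  also have "\<dots> = 2 * exp 1 * n\<^sup>2 - x" using False by (simp add: algebra_simps)
  finally have "peel_potential n x \<le> 2 * exp 1 * n\<^sup>2" by (simp add: peel_potential_def)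
  also have "\<dots> \<le> 6 * n\<^sup>2" using exp_le by (intro mult_right_mono) auto
  finally show ?thesis .
qed (simp add: peel_potential_def)

text \<open>Up to \<open>n^2\<close> the logarithm is nonnegative; this allows the potential
  remaining after the loop to be dropped.\<close>

lemma peel_potential_nonneg:
  assumes "0 \<le> x" "x \<le> n\<^sup>2"
  shows "0 \<le> peel_potential n x"
proof (cases "x = 0")
  case False
  have "1 * x \<le> (2 * exp 1) * n\<^sup>2"
    using assms exp_ge_add_one_self[of "1::real"] by (intro mult_mono) auto
  then have "1 \<le> 2 * exp 1 * n\<^sup>2 / x" using False assms by (simp add: field_simps)
  then show ?thesis using assms by (simp add: peel_potential_def)
qed (simp add: peel_potential_def)

lemma peel_t_correct:
  assumes G: "graph V E" and rep: "represents vs es V E" and n: "16 \<le> card V"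
    and m: "3 * real (card V) powr (3 / 2) \<le> real (card E)"
  defines "q \<equiv> param_q (card V) (card E)"
  shows "\<exists>A B es'. result (peel_t vs (es, F)) = (es', (A, B) # F) \<and>
    complete_bipartite_subgraph V E (set A, set B) \<and> card (set A) = q \<and> card (set B) = q \<and>
    card (cross_edges (set A, set B)) = q * q \<and>
    represents vs es' V (E - cross_edges (set A, set B)) \<and>
    steps (peel_t vs (es, F)) \<le> find_bipartite_bound (card V) (card E) + (8 * card V + 7) * card E + 2"
proof -
  obtain A B where AB: "result (find_bipartite vs es) = Some (A, B)"
    "complete_bipartite_subgraph V E (set A, set B)" "card (set A) = q" "card (set B) = q"
    "length A = q" "length B = q"
    using find_bipartite_correct[OF G rep n m] unfolding q_def by blast
  have "q \<le> card V" unfolding q_def by (rule param_q_bounds(2)[OF n m card_edges_le[OF G]])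
  then have "steps (delete_edges_t (A, B) es) \<le> (8 * card V + 7) * length es + 1"
    using AB by (intro steps_delete_edges_t) auto
  then have "steps (peel_t vs (es, F))
      \<le> find_bipartite_bound (card V) (card E) + (8 * card V + 7) * card E + 2"
    using steps_find_bipartite[OF G rep n m] length_eq_card_if_represents[OF rep] AB(1)
    by (simp add: peel_t_def)
  moreover have "card (cross_edges (set A, set B)) = q * q"
    using AB by (subst card_cross_edges) (auto simp: complete_bipartite_subgraph_def)
  moreover have "result (peel_t vs (es, F)) = (result (delete_edges_t (A, B) es), (A, B) # F)"
    using AB(1) by (simp add: peel_t_def)
  moreover have "represents vs (result (delete_edges_t (A, B) es)) V (E - cross_edges (set A, set B))"
    using represents_delete_edges_t[OF rep, of "(A, B)"] by (simp add: part_sets_def)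
  ultimately show ?thesis using AB by blast
qed

text \<open>One loop test, one round and the charge for the iteration, at the largest conceivable
  edge count; 5 collects the constants 2, 2 and 1.\<close>

definition peel_loop_bound :: "nat \<Rightarrow> nat" where
  "peel_loop_bound n = n\<^sup>2 + find_bipartite_bound n (n\<^sup>2) + (8 * n + 7) * n\<^sup>2 + 5"

lemma peel_loop_correct:
  assumes G: "graph V E" and rep: "represents vs es V E" and n: "card V = n" "16 \<le> n"
    and thr: "3 * real n powr (3 / 2) \<le> (real n)\<^sup>2 / ln (real n)"
  shows "\<exists>es' F t E'. while_timed (many_edges_t n) (peel_t vs) (es, []) = Some (Timed (es', F) t) \<and>
    E' \<subseteq> E \<and> represents vs es' V E' \<and> real (length es') \<le> (real n)\<^sup>2 / ln (real n) \<and>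
    decomposition V (E - E') (map part_sets F) \<and> balanced (map part_sets F) \<and>
    real (complexity (map part_sets F)) * ln (real n / 2) \<le> 24 * (real n)\<^sup>2 \<and>
    length F \<le> n\<^sup>2 \<and> t \<le> peel_loop_bound n * (n\<^sup>2 + 1)"
proof -
  define K where "K = peel_loop_bound n"
  define L where "L = ln (real n / 2)"
  \<comment> \<open>Besides the decomposition of the deleted edges, three budgets are tracked:
    complexity is paid from the potential, while the number of graphs found and the time are paid
    from the number of deleted edges.\<close>
  define inv where "inv = (\<lambda>((es', F), t). \<exists>E'. E' \<subseteq> E \<and> represents vs es' V E' \<and>
    decomposition V (E - E') (map part_sets F) \<and> balanced (map part_sets F) \<and>
    real (complexity (map part_sets F)) * L / 4 + peel_potential (real n) (real (card E'))
      \<le> peel_potential (real n) (real (card E)) \<and>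
    length F + card E' \<le> card E \<and> t + K * card E' \<le> K * card E)"
  let ?b = "\<lambda>(s, t::nat). result (many_edges_t n s)"
  let ?c = "\<lambda>(s, t). (result (peel_t vs s), t + steps (many_edges_t n s) + steps (peel_t vs s) + 1)"
  have step: "inv (?c s) \<and> length (fst (fst (?c s))) < length (fst (fst s))" if "inv s" "?b s" for s
  proof -
    obtain es1 F t where s: "s = ((es1, F), t)" by (metis surj_pair)
    obtain E1 where E1: "E1 \<subseteq> E" and rep1: "represents vs es1 V E1"
      and dec: "decomposition V (E - E1) (map part_sets F)" and bal: "balanced (map part_sets F)"
      and pot: "real (complexity (map part_sets F)) * L / 4 + peel_potential (real n) (real (card E1))
        \<le> peel_potential (real n) (real (card E))"
      and len: "length F + card E1 \<le> card E" and time: "t + K * card E1 \<le> K * card E"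
      using \<open>inv s\<close> unfolding inv_def s by auto
    have G1: "graph V E1" using G E1 by (auto simp: graph_def)
    note len1 = length_eq_card_if_represents[OF rep1]
    \<comment> \<open>The loop test and \<open>thr\<close> together put the current graph above the
      density that FIND-BIPARTITE requires.\<close>
    have m1: "3 * real (card V) powr (3 / 2) \<le> real (card E1)"
      using \<open>?b s\<close> thr n len1 by (simp add: s many_edges_t_def)
    have n16: "16 \<le> card V" using n by simp
    define q where "q = param_q (card V) (card E1)"
    obtain A B es2 where peel: "result (peel_t vs (es1, F)) = (es2, (A, B) # F)"
      and bip: "complete_bipartite_subgraph V E1 (set A, set B)"
      and card: "card (set A) = q" "card (set B) = q" "card (cross_edges (set A, set B)) = q * q"
      and rep2: "represents vs es2 V (E1 - cross_edges (set A, set B))"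
      and steps: "steps (peel_t vs (es1, F))
        \<le> find_bipartite_bound (card V) (card E1) + (8 * card V + 7) * card E1 + 2"
      using peel_t_correct[OF G1 rep1 n16 m1, of F] unfolding q_def by blast
    let ?X = "cross_edges (set A, set B)"
    note bounds = param_q_bounds[OF n16 m1 card_edges_le[OF G1], folded q_def, unfolded n(1)]
    have X: "?X \<subseteq> E1" using bip by (simp add: complete_bipartite_subgraph_def)
    have finE1: "finite E1" using G1 by (rule finite_graph_edges)
    have qq: "0 < q * q" using bounds(1) by simp
    have card_le: "q * q \<le> card E1" using card_mono[OF finE1 X] card by simp
    have card2: "card (E1 - ?X) = card E1 - q * q"
      using card_Diff_subset[OF finite_subset[OF X finE1] X] card by simp
    have "?X \<noteq> {}" using card(3) qq by (metis card.empty less_irrefl)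
    have bip': "complete_bipartite_subgraph V E (set A, set B)"
      using bip E1 by (auto simp: complete_bipartite_subgraph_def)
    have "decomposition V (?X \<union> (E - E1)) ([(set A, set B)] @ map part_sets F)"
      using decomposition_singleton[OF bip' \<open>?X \<noteq> {}\<close>] dec X by (intro decomposition_append) auto
    moreover have "?X \<union> (E - E1) = E - (E1 - ?X)" using X E1 by auto
    ultimately have dec2: "decomposition V (E - (E1 - ?X)) (map part_sets ((A, B) # F))"
      by (simp add: part_sets_def)
    have bal2: "balanced (map part_sets ((A, B) # F))"
      using bal card by (simp add: balanced_def part_sets_def)
    have cost: "complexity (map part_sets ((A, B) # F)) = 2 * q + complexity (map part_sets F)"
      using card by (simp add: part_sets_def)
    define l where "l = ln (2 * exp 1 * (real n)\<^sup>2 / real (card E1))"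
    \<comment> \<open>The new graph costs \<open>2 * q\<close>, which scaled by \<open>L / 4\<close>
      is \<open>q * L / 2\<close>. This is at most \<open>q * q * l\<close>, and the potential drops
      by at least that much when \<open>q * q\<close> edges go.\<close>
    have "real q * (L / 2) \<le> real q * (real q * l)"
      using bounds(3) by (intro mult_left_mono) (auto simp: L_def l_def)
    moreover have "peel_potential (real n) (real (card E1) - real (q * q)) + real (q * q) * l
        \<le> peel_potential (real n) (real (card E1))"
      using n card_le order_less_le_trans[OF qq card_le] unfolding l_def
      by (intro peel_potential_diff) (auto simp flip: of_nat_mult)
    then have "peel_potential (real n) (real (card (E1 - ?X))) + real q * (real q * l)
        \<le> peel_potential (real n) (real (card E1))"
      using card_le card2 by (simp add: of_nat_diff)
    ultimately have "real q * (L / 2) + peel_potential (real n) (real (card (E1 - ?X)))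
        \<le> peel_potential (real n) (real (card E1))"
      by linarith
    then have pot2: "real (complexity (map part_sets ((A, B) # F))) * L / 4
        + peel_potential (real n) (real (card (E1 - ?X))) \<le> peel_potential (real n) (real (card E))"
      using pot unfolding cost by (simp add: algebra_simps add_divide_distrib)
    have less: "Suc (card (E1 - ?X)) \<le> card E1" using card2 card_le qq by linarith
    have En: "card E1 \<le> n\<^sup>2" using card_edges_le[OF G1] n(1) by simp
    have "steps (many_edges_t n (es1, F)) = card E1 + 2" by (simp add: many_edges_t_def len1)
    moreover have "find_bipartite_bound n (card E1) \<le> find_bipartite_bound n (n\<^sup>2)"
      by (rule find_bipartite_bound_mono[OF En])
    moreover have "(8 * n + 7) * card E1 \<le> (8 * n + 7) * n\<^sup>2" using En by (intro mult_left_mono) auto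
    ultimately have "steps (many_edges_t n (es1, F)) + steps (peel_t vs (es1, F)) + 1 \<le> K"
      using steps En unfolding K_def peel_loop_bound_def n(1) by linarith
    \<comment> \<open>At least one edge disappears, and its share \<open>K\<close> pays for the
      whole round.\<close>
    moreover have "K * Suc (card (E1 - ?X)) \<le> K * card E1" using less by (intro mult_left_mono) auto
    ultimately have time2: "t + steps (many_edges_t n (es1, F)) + steps (peel_t vs (es1, F)) + 1
        + K * card (E1 - ?X) \<le> K * card E"
      using time by simp
    have "length ((A, B) # F) + card (E1 - ?X) \<le> card E" using len less by simp
    with dec2 bal2 pot2 time2 rep2 E1 have "inv (?c s)"
      unfolding s inv_def by (auto simp: peel intro!: exI[of _ "E1 - ?X"])
    moreover have "length (fst (fst (?c s))) < length (fst (fst s))"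
      using less len1 length_eq_card_if_represents[OF rep2] by (simp add: s peel)
    ultimately show ?thesis by blast
  qed
  have init: "inv ((es, []), 0)"
    unfolding inv_def using rep by (auto intro!: exI[of _ E] simp: decomposition_Nil balanced_def)
  have "\<exists>s. while_option ?b ?c ((es, []), 0) = Some s"
    by (rule measure_while_option_Some[where P = inv and f = "\<lambda>s. length (fst (fst s))"])
      (use step init in auto)
  then obtain s where "while_option ?b ?c ((es, []), 0) = Some s" by blast
  moreover obtain es' F t where "s = ((es', F), t)" by (metis surj_pair)
  ultimately have w: "while_option ?b ?c ((es, []), 0) = Some ((es', F), t)" by (simp only:)
  have "inv ((es', F), t)" by (rule while_option_rule[where P = inv, OF _ w init]) (rule step[THEN conjunct1])
  then obtain E' where E': "E' \<subseteq> E" and rep': "represents vs es' V E'"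
    and dec: "decomposition V (E - E') (map part_sets F)" and bal: "balanced (map part_sets F)"
    and pot: "real (complexity (map part_sets F)) * L / 4 + peel_potential (real n) (real (card E'))
        \<le> peel_potential (real n) (real (card E))"
    and len: "length F + card E' \<le> card E" and time: "t + K * card E' \<le> K * card E"
    unfolding inv_def by auto
  note len' = length_eq_card_if_represents[OF rep']
  have stop: "\<not> result (many_edges_t n (es', F))" using while_option_stop[OF w] by simp
  have loop: "while_timed (many_edges_t n) (peel_t vs) (es, [])
      = Some (Timed (es', F) (t + steps (many_edges_t n (es', F)) + 1))"
    using w by (simp add: while_timed_def case_prod_unfold)
  have E: "card E \<le> n\<^sup>2" using card_edges_le[OF G] n(1) by simp
  have E'n: "card E' \<le> n\<^sup>2" using len E by simp
  have "0 \<le> peel_potential (real n) (real (card E'))"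
    using E'n by (intro peel_potential_nonneg) (auto simp flip: of_nat_power)
  moreover have "peel_potential (real n) (real (card E)) \<le> 6 * (real n)\<^sup>2"
    using n by (intro peel_potential_le) auto
  ultimately have cost: "real (complexity (map part_sets F)) * L \<le> 24 * (real n)\<^sup>2"
    using pot by linarith
  \<comment> \<open>The final, failing test is not covered by the invariant; it fits into one more
    \<open>K\<close>, hence the factor \<open>n^2 + 1\<close>.\<close>
  have "t + steps (many_edges_t n (es', F)) + 1 \<le> K * card E + (n\<^sup>2 + 3)"
    using time E'n by (simp add: many_edges_t_def len')
  also have "\<dots> \<le> K * n\<^sup>2 + K"
    using E unfolding K_def peel_loop_bound_def by (intro add_mono mult_left_mono) auto
  finally have "t + steps (many_edges_t n (es', F)) + 1 \<le> K * (n\<^sup>2 + 1)" by simp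
  then show ?thesis
    using loop E' rep' dec bal cost len E stop unfolding K_def L_def
    by (intro exI[of _ es'] exI[of _ F] exI[of _ "t + steps (many_edges_t n (es', F)) + 1"]
        exI[of _ E'] conjI) (auto simp: many_edges_t_def)
qed

section \<open>Correctness of the brute-force search\<close>

text \<open>Since blocks are nonempty subsets of \<open>E\<close>, a repeated block or an overlap
  would cover some edge twice. Counting positions in the list detects repetitions that the set of
  blocks hides.\<close>

lemma partition_on_if_covered_once:
  assumes once: "\<And>e. e \<in> E \<Longrightarrow> length (filter (\<lambda>X. e \<in> X) Xs) = 1"
    and sub: "\<And>X. X \<in> set Xs \<Longrightarrow> X \<noteq> {} \<and> X \<subseteq> E"
  shows "distinct Xs" "partition_on E (set Xs)"
proof -
  have unique: "\<exists>Z. filter (\<lambda>X. e \<in> X) Xs = [Z]" if "e \<in> E" for e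
    using once[OF that] by (simp add: length_Suc_conv)
  show "distinct Xs"
  proof (rule ccontr)
    assume "\<not> distinct Xs"
    then obtain as bs cs X where Xs: "Xs = as @ [X] @ bs @ [X] @ cs"
      using not_distinct_decomp by blast
    then obtain e where "e \<in> X" "e \<in> E" using sub[of X] by auto
    then show False using once[of e] by (simp add: Xs)
  qed
  have eq: "X = Y" if "X \<in> set Xs" "Y \<in> set Xs" "e \<in> X" "e \<in> Y" for X Y e
  proof -
    have "e \<in> E" using sub that by blast
    then obtain Z where "filter (\<lambda>X. e \<in> X) Xs = [Z]" using unique by blast
    then have "set (filter (\<lambda>X. e \<in> X) Xs) = {Z}" by simp
    moreover have "X \<in> set (filter (\<lambda>X. e \<in> X) Xs)" "Y \<in> set (filter (\<lambda>X. e \<in> X) Xs)"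
      using that by auto
    ultimately show ?thesis by blast
  qed
  have "e \<in> \<Union> (set Xs)" if e: "e \<in> E" for e
  proof -
    obtain Z where "filter (\<lambda>X. e \<in> X) Xs = [Z]" using unique[OF e] by blast
    then have "Z \<in> set (filter (\<lambda>X. e \<in> X) Xs)" by simp
    then show ?thesis by auto
  qed
  then have "\<Union> (set Xs) = E" using sub by blast
  then show "partition_on E (set Xs)"
    using sub eq by (intro partition_onI) (auto simp: disjnt_iff)
qed

lemma result_is_balanced_biclique_t:
  "result (is_balanced_biclique_t es (A, B)) \<longleftrightarrow> 0 < length A \<and> length A = length B \<and>
     set A \<inter> set B = {} \<and> (\<forall>x\<in>set A. \<forall>y\<in>set B. {x, y} \<in> set (map edge_of es))"
  by (auto simp: is_balanced_biclique_t_def result_adjacent_t)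

lemma result_covers_exactly_t:
  "result (covers_exactly_t es F) \<longleftrightarrow>
     (\<forall>e\<in>set (map edge_of es). length (filter (\<lambda>G. e \<in> cross_edges (part_sets G)) F) = 1)"
  by (simp add: covers_exactly_t_def result_covers_t)

lemma cheapest_t_None: "result (cheapest_t Fs) = None \<Longrightarrow> Fs = []"
  by (cases Fs) (auto split: option.splits)

lemma cheapest_t_Some: "result (cheapest_t Fs) = Some (k, F) \<Longrightarrow> F \<in> set Fs"
  by (induction Fs arbitrary: k F) (auto split: option.splits if_splits)

lemma complexity_le:
  assumes "\<And>A B. (A, B) \<in> set Gs \<Longrightarrow> card A + card B \<le> k"
  shows "complexity Gs \<le> length Gs * k"
  using assms by (induction Gs) (fastforce intro: add_mono)+

definition candidates :: "'a list \<Rightarrow> ('a \<times> 'a) list \<Rightarrow> ('a list \<times> 'a list) list" where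
  "candidates vs es =
     filter (\<lambda>G. result (is_balanced_biclique_t es G)) (List.product (subseqs vs) (subseqs vs))"

lemma length_candidates: "length (candidates vs es) \<le> 2 ^ length vs * 2 ^ length vs"
  unfolding candidates_def by (rule order_trans[OF length_filter_le]) (simp add: length_subseqs)

lemma candidatesD:
  assumes "(A, B) \<in> set (candidates vs es)"
  shows "length A \<le> length vs" "length B \<le> length vs"
  using assms by (auto simp: candidates_def list_emb_length)

lemma candidates_correct:
  assumes rep: "represents vs es V E" and AB: "(A, B) \<in> set (candidates vs es)"
  shows "complete_bipartite_subgraph V E (set A, set B)" "card (set A) = card (set B)"
    "cross_edges (set A, set B) \<noteq> {}"
proof -
  have vs: "distinct vs" "set vs = V" and es: "set (map edge_of es) = E"
    using rep by (auto simp: represents_def)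
  have sub: "A \<in> set (subseqs vs)" "B \<in> set (subseqs vs)"
    and bip: "0 < length A" "length A = length B" "set A \<inter> set B = {}"
      "\<forall>x\<in>set A. \<forall>y\<in>set B. {x, y} \<in> E"
    using AB unfolding candidates_def result_is_balanced_biclique_t es[symmetric]
    by (auto simp: result_is_balanced_biclique_t simp del: in_set_subseqs)
  have "distinct A" "distinct B" using sub vs subseqs_distinctD by blast+
  then show "card (set A) = card (set B)" using bip by (simp add: distinct_card)
  have "set A \<in> Pow V" "set B \<in> Pow V"
    using sub unfolding vs(2)[symmetric] subseqs_powset[symmetric] by blast+
  then show "complete_bipartite_subgraph V E (set A, set B)"
    using bip by (auto simp: complete_bipartite_subgraph_def cross_edges_def)
  obtain a b where "a \<in> set A" "b \<in> set B" using bip(1,2) by (metis nth_mem)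
  then show "cross_edges (set A, set B) \<noteq> {}" by (auto simp: cross_edges_def)
qed

text \<open>The family of all single edges is always available, so the search has something to
  choose from.\<close>

lemma brute_force_candidate_exists:
  assumes G: "graph V E" and rep: "represents vs es V E"
  shows "\<exists>F\<in>set (subseqs (candidates vs es)). result (covers_exactly_t es F)"
proof
  let ?K = "\<lambda>(u, v). ([u], [v])"
  \<comment> \<open>The candidates contain each single edge in both orientations. Keeping only the
    orientation listed in \<open>es\<close> makes every edge covered once rather than twice.\<close>
  let ?F = "filter (\<lambda>G. G \<in> ?K ` set es) (candidates vs es)"
  show "?F \<in> set (subseqs (candidates vs es))" by simp
  have vs: "distinct vs" "set vs = V" and es: "distinct (map edge_of es)" "set (map edge_of es) = E"
    using rep by (auto simp: represents_def)
  have "distinct (subseqs vs)" using distinct_set_subseqs[OF vs(1)] by (simp add: distinct_map)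
  then have dist: "distinct (candidates vs es)"
    unfolding candidates_def by (intro distinct_filter distinct_product)
  have cross: "cross_edges (part_sets (?K e)) = {edge_of e}" for e :: "'a \<times> 'a"
    by (auto simp: cross_edges_def part_sets_def edge_of_def split: prod.split)
  have mem: "?K e \<in> set (candidates vs es)" if "e \<in> set es" for e
  proof -
    obtain u v where e: "e = (u, v)" by (cases e)
    have "edge_of e \<in> E" using that es(2) by auto
    then have "edge_of e \<subseteq> V" "card (edge_of e) = 2" using G by (auto simp: graph_def)
    then have "u \<in> set vs" "v \<in> set vs" "u \<noteq> v" by (auto simp: e edge_of_def vs)
    moreover have "{u, v} \<in> set (map edge_of es)"
      using \<open>edge_of e \<in> E\<close> es(2) by (simp add: e edge_of_def)
    ultimately show ?thesis
      by (simp add: candidates_def e result_is_balanced_biclique_t subseq_singleton_left del: set_map)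
  qed
  have "length (filter (\<lambda>G. edge_of e \<in> cross_edges (part_sets G)) ?F) = 1" if "e \<in> set es" for e
  proof -
    have inj: "inj_on edge_of (set es)" using es(1) by (simp add: distinct_map)
    have "set (filter (\<lambda>G. edge_of e \<in> cross_edges (part_sets G)) ?F) = {?K e}" (is "?L = ?R")
    proof
      show "?L \<subseteq> ?R"
      proof
        fix G assume "G \<in> ?L"
        then obtain e' where e': "e' \<in> set es" "G = ?K e'" "edge_of e \<in> cross_edges (part_sets G)"
          by auto
        then have "edge_of e = edge_of e'" using cross[of e'] by simp
        then have "e = e'" using inj e'(1) that by (auto dest: inj_onD)
        then show "G \<in> ?R" using e' by simp
      qed
      show "?R \<subseteq> ?L" using mem[OF that] that cross[of e] by auto
    qed
    moreover have "distinct (filter (\<lambda>G. edge_of e \<in> cross_edges (part_sets G)) ?F)"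
      using dist by (intro distinct_filter)
    ultimately show ?thesis using distinct_card by fastforce
  qed
  then show "result (covers_exactly_t es ?F)" unfolding result_covers_exactly_t by auto
qed

text \<open>The complexity bound counts at most \<open>4 ^ n\<close> candidates with at most
  \<open>2 * n\<close> vertices each: crude, but bounded below the threshold.\<close>

lemma brute_force_correct:
  assumes G: "graph V E" and rep: "represents vs es V E"
  defines "F \<equiv> result (brute_force vs es)"
  shows "decomposition V E (map part_sets F)" "balanced (map part_sets F)"
    "complexity (map part_sets F) \<le> 2 ^ card V * 2 ^ card V * (2 * card V)"
proof -
  let ?Ds = "filter (\<lambda>F. result (covers_exactly_t es F)) (subseqs (candidates vs es))"
  have F: "F = (case result (cheapest_t ?Ds) of None \<Rightarrow> [] | Some (k, F) \<Rightarrow> F)"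
    by (simp add: F_def brute_force_def candidates_def)
  have "?Ds \<noteq> []" using brute_force_candidate_exists[OF G rep] by (auto simp: filter_empty_conv)
  then obtain k F' where "result (cheapest_t ?Ds) = Some (k, F')"
    using cheapest_t_None by (metis not_None_eq surj_pair)
  then have "F \<in> set ?Ds" using cheapest_t_Some F by fastforce
  then have sub: "subseq F (candidates vs es)" and cov: "result (covers_exactly_t es F)" by auto
  have set: "set F \<subseteq> set (candidates vs es)" using list_emb_set[OF sub] by blast
  note cand = candidates_correct[OF rep subsetD[OF set]]
  have once: "length (filter (\<lambda>X. e \<in> X) (map cross_edges (map part_sets F))) = 1" if "e \<in> E" for e
  proof -
    have "e \<in> set (map edge_of es)" using rep that by (simp add: represents_def)
    then have "length (filter (\<lambda>G. e \<in> cross_edges (part_sets G)) F) = 1"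
      using cov unfolding result_covers_exactly_t by blast
    then show ?thesis by (simp add: filter_map o_def)
  qed
  have ne: "X \<noteq> {} \<and> X \<subseteq> E" if "X \<in> set (map cross_edges (map part_sets F))" for X
    using that cand by (auto simp: part_sets_def complete_bipartite_subgraph_def)
  show "decomposition V E (map part_sets F)"
    unfolding decomposition_def
    using partition_on_if_covered_once[OF once ne] cand by (auto simp: part_sets_def)
  show "balanced (map part_sets F)"
    using cand by (auto simp: balanced_def part_sets_def)
  have "complexity (map part_sets F) \<le> length (map part_sets F) * (2 * card V)"
  proof (rule complexity_le)
    fix A B assume "(A, B) \<in> set (map part_sets F)"
    then obtain as bs where "(as, bs) \<in> set F" "A = set as" "B = set bs"
      by (auto simp: part_sets_def)
    then have "A \<subseteq> V" "B \<subseteq> V" using cand(1) by (auto simp: complete_bipartite_subgraph_def)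
    then have "card A \<le> card V" "card B \<le> card V" using G by (auto simp: graph_def intro: card_mono)
    then show "card A + card B \<le> 2 * card V" by simp
  qed
  also have "\<dots> \<le> 2 ^ card V * 2 ^ card V * (2 * card V)"
    using list_emb_length[OF sub] length_candidates[of vs es] length_eq_card_if_represents[OF rep]
    by (intro mult_right_mono) auto
  finally show "complexity (map part_sets F) \<le> 2 ^ card V * 2 ^ card V * (2 * card V)" .
qed

section \<open>Running time of the brute-force search\<close>

lemma steps_is_balanced_biclique_t:
  assumes "length A \<le> n" "length B \<le> n"
  shows "steps (is_balanced_biclique_t es (A, B))
    \<le> 2 * n + 5 + (2 * n + 3) * n + ((2 * length es + 2) * n + 2) * n"
proof -
  have "steps (all_t (\<lambda>x. bind_timed (member_t x B) (\<lambda>i. ret (\<not> i))) A)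
      \<le> (2 * n + 2 + 1) * length A + 1"
  proof (rule steps_all_t)
    fix x
    show "steps (bind_timed (member_t x B) (\<lambda>i. ret (\<not> i))) \<le> 2 * n + 2"
      using steps_member_t[of x B] assms by simp
  qed
  also have "\<dots> \<le> (2 * n + 2 + 1) * n + 1" using assms by (intro add_mono mult_left_mono) auto
  finally have 1: "steps (all_t (\<lambda>x. bind_timed (member_t x B) (\<lambda>i. ret (\<not> i))) A)
      \<le> (2 * n + 2 + 1) * n + 1" .
  have "steps (all_t (\<lambda>y. adjacent_t es x y) B) \<le> (2 * length es + 1 + 1) * n + 1" for x
    by (rule order_trans[OF steps_all_t[OF steps_adjacent_t]])
      (use assms in \<open>intro add_mono mult_left_mono, auto\<close>)
  then have "steps (all_t (\<lambda>x. all_t (\<lambda>y. adjacent_t es x y) B) A)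
      \<le> ((2 * length es + 1 + 1) * n + 1 + 1) * length A + 1"
    by (intro steps_all_t)
  also have "\<dots> \<le> ((2 * length es + 1 + 1) * n + 1 + 1) * n + 1"
    using assms by (intro add_mono mult_left_mono) auto
  finally have 2: "steps (all_t (\<lambda>x. all_t (\<lambda>y. adjacent_t es x y) B) A)
      \<le> ((2 * length es + 1 + 1) * n + 1 + 1) * n + 1" .
  show ?thesis using 1 2 assms by (simp add: is_balanced_biclique_t_def algebra_simps)
qed

lemma steps_covers_exactly_t:
  assumes "\<And>A B. (A, B) \<in> set F \<Longrightarrow> length A \<le> n \<and> length B \<le> n" "length F \<le> p"
  shows "steps (covers_exactly_t es F) \<le> ((8 * n + 7) * p + 4) * length es + 1"
proof -
  have "steps (covers_exactly_t es F) \<le> ((8 * n + 7) * p + 3 + 1) * length es + 1"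
    unfolding covers_exactly_t_def
  proof (rule steps_all_t)
    fix e
    have "steps (filter_t (covers_t e) F) \<le> (8 * n + 5 + 1) * length F + 1"
    proof (rule steps_filter_t)
      fix G assume "G \<in> set F"
      then show "steps (covers_t e G) \<le> 8 * n + 5"
        using steps_covers_t[of e "fst G" "snd G"] assms(1)[of "fst G" "snd G"] by simp
    qed
    also have "\<dots> \<le> (8 * n + 5 + 1) * p + 1" using assms(2) by (intro add_mono mult_left_mono) auto
    finally have "steps (filter_t (covers_t e) F) \<le> (8 * n + 5 + 1) * p + 1" .
    moreover have "length (result (filter_t (covers_t e) F)) \<le> p"
      using assms(2) by (simp add: order_trans[OF length_filter_le])
    ultimately show "steps (bind_timed (filter_t (covers_t e) F)
        (\<lambda>G. bind_timed (length_t G) (\<lambda>k. ret (k = 1)))) \<le> (8 * n + 7) * p + 3"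
      by (simp add: algebra_simps del: result_filter_t)
  qed
  then show ?thesis by (simp add: algebra_simps)
qed

lemma steps_complexity_t:
  assumes "\<And>A B. (A, B) \<in> set F \<Longrightarrow> length A \<le> n \<and> length B \<le> n"
  shows "steps (complexity_t F) \<le> (2 * n + 3) * length F + 1"
  using assms
proof (induction F)
  case (Cons G F)
  have "length (fst G) \<le> n" "length (snd G) \<le> n" using Cons.prems[of "fst G" "snd G"] by auto
  moreover have "steps (complexity_t F) \<le> (2 * n + 3) * length F + 1" using Cons by auto
  ultimately show ?case by simp
qed simp

lemma steps_cheapest_t:
  assumes "\<And>F. F \<in> set Fs \<Longrightarrow> steps (complexity_t F) \<le> k"
  shows "steps (cheapest_t Fs) \<le> (k + 1) * length Fs + 1"
  using assms by (induction Fs) fastforce+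

text \<open>\<open>p\<close> bounds the number of candidates, so at most \<open>2 ^ p\<close>
  families are examined. The double exponential is evaluated only at sizes below the
  threshold.\<close>

definition brute_force_bound :: "nat \<Rightarrow> nat \<Rightarrow> nat" where
  "brute_force_bound n m = (let p = 2 ^ n * 2 ^ n in
     6 * 4 ^ n + (2 ^ n * (3 * 2 ^ n + 3) + 1)
     + ((2 * n + 5 + (2 * n + 3) * n + ((2 * m + 2) * n + 2) * n + 1) * p + 1)
     + 6 * 4 ^ p + ((((8 * n + 7) * p + 4) * m + 1 + 1) * 2 ^ p + 1)
     + (((2 * n + 3) * p + 1 + 1) * 2 ^ p + 1) + 1)"

lemma steps_brute_force: "steps (brute_force vs es) \<le> brute_force_bound (length vs) (length es)"
proof -
  define n m p where "n = length vs" and "m = length es" and "p = (2 ^ n * 2 ^ n :: nat)"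
  let ?P = "List.product (subseqs vs) (subseqs vs)"
  let ?Gs = "candidates vs es"
  let ?Ds = "filter (\<lambda>F. result (covers_exactly_t es F)) (subseqs ?Gs)"
  have lenP: "length ?P = p" by (simp add: length_subseqs p_def n_def)
  have lenG: "length ?Gs \<le> p" using length_candidates[of vs es] by (simp add: p_def n_def)
  have lenS: "length (subseqs ?Gs) \<le> 2 ^ p" using lenG by (simp add: length_subseqs power_increasing)
  have lenD: "length ?Ds \<le> 2 ^ p" using lenS by (meson length_filter_le order_trans)
  have F: "length F \<le> p" "\<And>A B. (A, B) \<in> set F \<Longrightarrow> length A \<le> n \<and> length B \<le> n"
    if "F \<in> set (subseqs ?Gs)" for F
  proof -
    have sub: "subseq F ?Gs" using that by simp
    show "length F \<le> p" using list_emb_length[OF sub] lenG by simp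
    fix A B assume "(A, B) \<in> set F"
    then have "(A, B) \<in> set ?Gs" using list_emb_set[OF sub] by blast
    then show "length A \<le> n \<and> length B \<le> n" using candidatesD by (auto simp: n_def)
  qed
  have "steps (sublists_t vs) \<le> 6 * 4 ^ n" using steps_sublists_t[of vs] by (simp add: n_def)
  moreover have "steps (product_t (subseqs vs) (subseqs vs)) \<le> 2 ^ n * (3 * 2 ^ n + 3) + 1"
    using steps_product_t[of "subseqs vs" "subseqs vs"] by (simp add: length_subseqs n_def)
  moreover have "steps (filter_t (is_balanced_biclique_t es) ?P)
      \<le> (2 * n + 5 + (2 * n + 3) * n + ((2 * m + 2) * n + 2) * n + 1) * length ?P + 1"
  proof (rule steps_filter_t)
    fix G assume "G \<in> set ?P"
    then obtain A B where G: "G = (A, B)" "length A \<le> n" "length B \<le> n"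
      by (auto simp: n_def list_emb_length)
    show "steps (is_balanced_biclique_t es G)
        \<le> 2 * n + 5 + (2 * n + 3) * n + ((2 * m + 2) * n + 2) * n"
      unfolding G(1) m_def by (rule steps_is_balanced_biclique_t[OF G(2,3)])
  qed
  moreover have "steps (sublists_t ?Gs) \<le> 6 * 4 ^ p"
  proof -
    have "(4::nat) ^ length ?Gs \<le> 4 ^ p" using lenG by (intro power_increasing) auto
    then show ?thesis using steps_sublists_t[of ?Gs] by linarith
  qed
  moreover have "steps (filter_t (covers_exactly_t es) (subseqs ?Gs))
      \<le> (((8 * n + 7) * p + 4) * m + 1 + 1) * 2 ^ p + 1"
  proof -
    have "steps (filter_t (covers_exactly_t es) (subseqs ?Gs))
        \<le> (((8 * n + 7) * p + 4) * m + 1 + 1) * length (subseqs ?Gs) + 1"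
      unfolding m_def by (intro steps_filter_t steps_covers_exactly_t F)
    also have "\<dots> \<le> (((8 * n + 7) * p + 4) * m + 1 + 1) * 2 ^ p + 1"
      using lenS by (intro add_mono mult_left_mono) auto
    finally show ?thesis .
  qed
  moreover have "steps (cheapest_t ?Ds) \<le> ((2 * n + 3) * p + 1 + 1) * 2 ^ p + 1"
  proof -
    have "steps (cheapest_t ?Ds) \<le> ((2 * n + 3) * p + 1 + 1) * length ?Ds + 1"
    proof (rule steps_cheapest_t)
      fix F' assume "F' \<in> set ?Ds"
      then have F': "F' \<in> set (subseqs ?Gs)" by simp
      have "steps (complexity_t F') \<le> (2 * n + 3) * length F' + 1"
        by (rule steps_complexity_t) (rule F(2)[OF F'])
      also have "\<dots> \<le> (2 * n + 3) * p + 1" using F(1)[OF F'] by (intro add_mono mult_left_mono) auto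
      finally show "steps (complexity_t F') \<le> (2 * n + 3) * p + 1" .
    qed
    also have "\<dots> \<le> ((2 * n + 3) * p + 1 + 1) * 2 ^ p + 1"
      using lenD by (intro add_mono mult_left_mono) auto
    finally show ?thesis .
  qed
  moreover have "steps (brute_force vs es) = steps (sublists_t vs)
      + steps (product_t (subseqs vs) (subseqs vs)) + steps (filter_t (is_balanced_biclique_t es) ?P)
      + steps (sublists_t ?Gs) + steps (filter_t (covers_exactly_t es) (subseqs ?Gs))
      + steps (cheapest_t ?Ds) + 1"
    by (simp add: brute_force_def candidates_def)
  ultimately show ?thesis
    unfolding brute_force_bound_def Let_def n_def[symmetric] m_def[symmetric] p_def[symmetric] lenP
    by linarith
qed

section \<open>FIND-DECOMPOSITION\<close>

text \<open>With \<open>s = sqrt x\<close> the claim becomes \<open>3 * ln x \<le> s\<close>. Here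
  \<open>3 * ln x = 6 * ln s \<le> 12 * sqrt s\<close>, and 20736 = 12^4 is where
  \<open>sqrt s\<close> reaches 12.\<close>

lemma three_halves_power_le_square_div_ln:
  assumes "20736 \<le> (x::real)"
  shows "3 * x powr (3 / 2) \<le> x\<^sup>2 / ln x"
proof -
  define s where "s = sqrt x"
  have "sqrt (sqrt 20736) \<le> sqrt s" using assms unfolding s_def by (intro real_sqrt_le_mono)
  moreover have "sqrt 20736 = (144::real)" "sqrt 144 = (12::real)"
    by (rule real_sqrt_unique; simp)+
  ultimately have s12: "12 \<le> sqrt s" by simp
  have s0: "0 < s" using assms by (simp add: s_def)
  have "3 * ln x = 6 * ln s" using assms by (simp add: s_def ln_sqrt)
  also have "\<dots> \<le> 12 * sqrt s" using ln_le_two_sqrt[OF s0] by simp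
  also have "\<dots> \<le> sqrt s * sqrt s" using s12 s0 by (intro mult_right_mono) auto
  also have "\<dots> = s" using s0 by simp
  finally have ln: "3 * ln x \<le> s" .
  have "x powr (3 / 2) = x powr (1 + 1 / 2)" by simp
  also have "\<dots> = x * s" unfolding powr_add using assms by (simp add: powr_half_sqrt s_def)
  finally have "3 * x powr (3 / 2) * ln x = x * s * (3 * ln x)" by simp
  also have "\<dots> \<le> x * s * s" using ln s0 assms by (intro mult_left_mono) auto
  also have "\<dots> = x\<^sup>2" using assms by (simp add: s_def power2_eq_square)
  finally show ?thesis using assms by (simp add: field_simps)
qed

text \<open>The bound uses only sums, products and powers, so the same expression in the monomial
  \<open>X\<close> is the polynomial. The terms after the loop bound cover counting the vertices,
  converting the remaining edges and the final append.\<close>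

lemma poly_peel_loop_bound:
  "\<exists>p :: nat poly. \<forall>n. poly p n = peel_loop_bound n * (n\<^sup>2 + 1) + 3 * n\<^sup>2 + n + 4"
proof -
  define X :: "nat poly" where "X = [:0, 1:]"
  have X: "poly X n = n" for n by (simp add: X_def)
  let ?f = "X + X\<^sup>2 + 4 + ((3 * X\<^sup>2 + 4) * X + X * X + 5 * X + 4)
     + 6 * (X + 1) * ((X + 1) * X) + (X * ((2 * X\<^sup>2 + 8) * X * X + 6 * X + 4) + 1)"
  let ?p = "(X\<^sup>2 + ?f + (8 * X + 7) * X\<^sup>2 + 5) * (X\<^sup>2 + 1) + 3 * X\<^sup>2 + X + 4"
  have "poly ?p n = peel_loop_bound n * (n\<^sup>2 + 1) + 3 * n\<^sup>2 + n + 4" for n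
    unfolding peel_loop_bound_def find_bipartite_bound_def
    by (simp only: poly_add poly_mult poly_power poly_numeral poly_1 X)
  then show ?thesis by blast
qed

lemma find_decomposition_large:
  assumes G: "graph V E" and rep: "represents vs es V E"
    and n: "card V = n" "n\<^sub>0 \<le> n" "20736 \<le> n\<^sub>0"
  shows "\<exists>F t. find_decomposition n\<^sub>0 vs es = Some (Timed F t) \<and>
    decomposition V E (map part_sets F) \<and> balanced (map part_sets F) \<and>
    real (complexity (map part_sets F)) \<le> 50 * (real n)\<^sup>2 / ln (real n) \<and>
    t \<le> peel_loop_bound n * (n\<^sup>2 + 1) + 3 * n\<^sup>2 + n + 4"
proof -
  note lens = length_eq_card_if_represents[OF rep]
  have "3 * real n powr (3 / 2) \<le> (real n)\<^sup>2 / ln (real n)"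
    using n by (intro three_halves_power_le_square_div_ln) simp
  then obtain es' F t E' where
    loop: "while_timed (many_edges_t n) (peel_t vs) (es, []) = Some (Timed (es', F) t)"
    and E': "E' \<subseteq> E" and rep': "represents vs es' V E'"
    and few: "real (length es') \<le> (real n)\<^sup>2 / ln (real n)"
    and dec: "decomposition V (E - E') (map part_sets F)" and bal: "balanced (map part_sets F)"
    and cost: "real (complexity (map part_sets F)) * ln (real n / 2) \<le> 24 * (real n)\<^sup>2"
    and lenF: "length F \<le> n\<^sup>2" and time: "t \<le> peel_loop_bound n * (n\<^sup>2 + 1)"
    using peel_loop_correct[OF G rep n(1)] n(2,3) by auto
  let ?Ks = "map (\<lambda>(u, v). ([u], [v])) es'"
  let ?out = "bind_timed (length_t vs) (\<lambda>_. bind_timed (Timed (es', F) t)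
    (\<lambda>s. bind_timed (map_t (\<lambda>(u, v). ret ([u], [v])) (fst s)) (append_t (snd s))))"
  have find: "find_decomposition n\<^sub>0 vs es = Some ?out"
    using loop n by (simp add: find_decomposition_def lens Let_def)
  have out: "result ?out = F @ ?Ks" by (simp add: case_prod_unfold)
  have G': "graph V E'" using G E' by (auto simp: graph_def)
  have es': "set (map edge_of es') = E'" "distinct (map edge_of es')"
    using rep' by (auto simp: represents_def)
  have "decomposition V (E - E' \<union> E') (map part_sets F @ map part_sets ?Ks)"
    using dec decomposition_single_edges[of V es'] G' unfolding es'
    by (intro decomposition_append) (auto simp: es')
  then have "decomposition V E (map part_sets (F @ ?Ks))" using E' by (simp add: Un_absorb2)
  moreover have "balanced (map part_sets (F @ ?Ks))"
    using bal by (auto simp: balanced_def part_sets_def)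
  moreover have "real (complexity (map part_sets (F @ ?Ks))) \<le> 50 * (real n)\<^sup>2 / ln (real n)"
  proof -
    have n4: "4 \<le> real n" using n by simp
    then have ln0: "0 < ln (real n)" by simp
    \<comment> \<open>For \<open>n \<ge> 4\<close>, \<open>ln n \<le> 2 * ln (n / 2)\<close>. This
      doubles 24 to 48, and the remaining single edges, at cost 2 each, bring the constant to
      50.\<close>
    have "ln 4 \<le> ln (real n)" using n4 by simp
    moreover have "ln (4::real) = 2 * ln 2" using ln_realpow[of "2::real" 2] by simp
    ultimately have "ln (real n) \<le> 2 * ln (real n / 2)" using n4 by (simp add: ln_div)
    then have "real (complexity (map part_sets F)) * ln (real n)
        \<le> real (complexity (map part_sets F)) * (2 * ln (real n / 2))"
      by (intro mult_left_mono) auto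
    then have "real (complexity (map part_sets F)) * ln (real n) \<le> 48 * (real n)\<^sup>2"
      using cost by linarith
    then have "real (complexity (map part_sets F)) \<le> 48 * (real n)\<^sup>2 / ln (real n)"
      using ln0 by (simp add: pos_le_divide_eq)
    moreover have "real (complexity (map part_sets ?Ks)) \<le> 2 * ((real n)\<^sup>2 / ln (real n))"
      using few unfolding complexity_single_edges by simp
    ultimately show ?thesis by (simp only: map_append complexity_append of_nat_add)
  qed
  moreover have "steps ?out \<le> peel_loop_bound n * (n\<^sup>2 + 1) + 3 * n\<^sup>2 + n + 4"
  proof -
    have "length es' \<le> n\<^sup>2"
      using card_edges_le[OF G'] n(1) length_eq_card_if_represents[OF rep'] by simp
    moreover have "steps (map_t (\<lambda>(u, v). ret ([u], [v])) es') \<le> (1 + 1) * length es' + 1"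
      by (intro steps_map_t) (auto split: prod.split)
    ultimately show ?thesis using time lenF n(1) by (simp add: lens)
  qed
  moreover have "find_decomposition n\<^sub>0 vs es = Some (Timed (F @ ?Ks) (steps ?out))"
    unfolding find out[symmetric] timed.collapse ..
  ultimately show ?thesis by blast
qed

lemma find_decomposition_small:
  assumes G: "graph V E" and rep: "represents vs es V E" and n: "card V < n\<^sub>0"
  shows "\<exists>F t. find_decomposition n\<^sub>0 vs es = Some (Timed F t) \<and>
    decomposition V E (map part_sets F) \<and> balanced (map part_sets F) \<and>
    complexity (map part_sets F) \<le> 2 ^ card V * 2 ^ card V * (2 * card V) \<and>
    t \<le> card V + 1 + brute_force_bound (card V) (card E)"
proof -
  note lens = length_eq_card_if_represents[OF rep]
  have "find_decomposition n\<^sub>0 vs es = Some (bind_timed (length_t vs) (\<lambda>_. brute_force vs es))"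
    using n by (simp add: find_decomposition_def lens Let_def)
  also have "\<dots> = Some (Timed (result (brute_force vs es)) (card V + 1 + steps (brute_force vs es)))"
    by (simp add: timed.expand lens)
  finally show ?thesis
    using brute_force_correct[OF G rep] steps_brute_force[of vs es] unfolding lens by auto
qed

text \<open>\<open>c\<close> and \<open>p\<close> are chosen after the threshold, so they can absorb
  the exponential cost of the finitely many sizes below it.\<close>

theorem theorem2:
  shows "\<forall>\<^sub>F n\<^sub>0 in sequentially. bipartite_threshold n\<^sub>0 \<and>
    (\<exists>(c :: real) (p :: nat poly). c > 0 \<and>
      (\<forall>(n :: nat) (V :: nat set) E vs es.
         n \<ge> 2 \<and> graph V E \<and> card V = n \<and> represents vs es V E \<longrightarrow>
         (\<exists>F t. find_decomposition n\<^sub>0 vs es = Some (Timed F t) \<and>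
            decomposition V E (map part_sets F) \<and>
            balanced (map part_sets F) \<and>
            real (complexity (map part_sets F)) \<le> c * (real n)\<^sup>2 / ln (real n) \<and>
            t \<le> poly p n)))"
proof (rule eventually_sequentiallyI[of 20736], rule conjI)
  fix n\<^sub>0 :: nat assume n0: "20736 \<le> n\<^sub>0"
  show "bipartite_threshold n\<^sub>0"
    unfolding bipartite_threshold_def
  proof (intro allI impI, elim conjE)
    fix V :: "nat set" and E vs es
    assume "graph V E" "represents vs es V E" "n\<^sub>0 \<le> card V"
      "3 * real (card V) powr (3 / 2) \<le> real (card E)"
    then show "\<exists>C D. result (find_bipartite vs es) = Some (C, D) \<and>
           complete_bipartite_subgraph V E (set C, set D) \<and>
           card (set C) = param_q (card V) (card E) \<and>
           card (set D) = param_q (card V) (card E)"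
      using find_bipartite_correct[of V E vs es] n0 by auto
  qed
  \<comment> \<open>Sums over the finitely many small sizes, and over all possible edge counts,
    stand in for maxima.\<close>
  define k where "k = (\<Sum>i<n\<^sub>0. 2 ^ i * 2 ^ i * (2 * i) :: nat)"
  define K where "K = (\<Sum>i<n\<^sub>0. \<Sum>j\<le>i\<^sup>2. i + 1 + brute_force_bound i j)"
  obtain p :: "nat poly"
    where p: "\<And>n. poly p n = peel_loop_bound n * (n\<^sup>2 + 1) + 3 * n\<^sup>2 + n + 4"
    using poly_peel_loop_bound by blast
  show "\<exists>(c :: real) (p :: nat poly). c > 0 \<and>
      (\<forall>(n :: nat) (V :: nat set) E vs es.
         n \<ge> 2 \<and> graph V E \<and> card V = n \<and> represents vs es V E \<longrightarrow>
         (\<exists>F t. find_decomposition n\<^sub>0 vs es = Some (Timed F t) \<and>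
            decomposition V E (map part_sets F) \<and>
            balanced (map part_sets F) \<and>
            real (complexity (map part_sets F)) \<le> c * (real n)\<^sup>2 / ln (real n) \<and>
            t \<le> poly p n))"
  proof (intro exI[of _ "50 + real k"] exI[of _ "[:K:] + p"] conjI allI impI; (elim conjE)?)
    fix n :: nat and V :: "nat set" and E vs es
    assume n2: "2 \<le> n" and G: "graph V E" and n: "card V = n" and rep: "represents vs es V E"
    let ?b = "(real n)\<^sup>2 / ln (real n)"
    have ln0: "0 < ln (real n)" using n2 by simp
    \<comment> \<open>\<open>n^2 / ln n\<close> is at least 1, so the additive constant
      \<open>k\<close> can join the multiplicative one.\<close>
    have "ln (real n) \<le> real n" using n2 by (intro ln_bound) simp
    also have "\<dots> \<le> (real n)\<^sup>2" using n2 by (simp add: power2_eq_square)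
    finally have b1: "1 \<le> ?b" using ln0 by simp
    show "\<exists>F t. find_decomposition n\<^sub>0 vs es = Some (Timed F t) \<and>
            decomposition V E (map part_sets F) \<and>
            balanced (map part_sets F) \<and>
            real (complexity (map part_sets F)) \<le> (50 + real k) * (real n)\<^sup>2 / ln (real n) \<and>
            t \<le> poly ([:K:] + p) n"
    proof (cases "n < n\<^sub>0")
      case True
      then obtain F t where F: "find_decomposition n\<^sub>0 vs es = Some (Timed F t)"
        "decomposition V E (map part_sets F)" "balanced (map part_sets F)"
        and cost: "complexity (map part_sets F) \<le> 2 ^ n * 2 ^ n * (2 * n)"
        and time: "t \<le> n + 1 + brute_force_bound n (card E)"
        using find_decomposition_small[OF G rep] n by blast
      have "2 ^ n * 2 ^ n * (2 * n) \<le> k"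
        unfolding k_def using True by (intro member_le_sum) auto
      then have "real (complexity (map part_sets F)) \<le> (50 + real k) * 1" using cost by simp
      also have "\<dots> \<le> (50 + real k) * ?b" using b1 by (intro mult_left_mono) auto
      finally have "real (complexity (map part_sets F)) \<le> (50 + real k) * (real n)\<^sup>2 / ln (real n)"
        by simp
      moreover have "n + 1 + brute_force_bound n (card E) \<le> K"
      proof -
        have "card E \<le> n\<^sup>2" using card_edges_le[OF G] n by simp
        then have "n + 1 + brute_force_bound n (card E)
            \<le> (\<Sum>j\<le>n\<^sup>2. n + 1 + brute_force_bound n j)"
          by (intro member_le_sum) auto
        also have "\<dots> \<le> K" unfolding K_def using True by (intro member_le_sum) auto
        finally show ?thesis .
      qed
      ultimately show ?thesis using F time by (intro exI[of _ F] exI[of _ t]) simp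
    next
      case False
      then obtain F t where F: "find_decomposition n\<^sub>0 vs es = Some (Timed F t)"
        "decomposition V E (map part_sets F)" "balanced (map part_sets F)"
        and cost: "real (complexity (map part_sets F)) \<le> 50 * (real n)\<^sup>2 / ln (real n)"
        and time: "t \<le> peel_loop_bound n * (n\<^sup>2 + 1) + 3 * n\<^sup>2 + n + 4"
        using find_decomposition_large[OF G rep n _ n0] by auto
      have "50 * ?b \<le> (50 + real k) * ?b" using b1 by (intro mult_right_mono) auto
      then have "real (complexity (map part_sets F)) \<le> (50 + real k) * (real n)\<^sup>2 / ln (real n)"
        using cost by simp
      then show ?thesis using F time by (intro exI[of _ F] exI[of _ t]) (simp add: p)
    qed
  qed simp
qed

end
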